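(* Let $n\ge1$, $0<\sigma_0<\sigma_1<1$, and $1\le p<1+\frac{4}{n-1}$. For every sufficiently large $\eta>1$ and every $C>1$ there exist $\alpha_0>0$ (small with respect to $p$ and $C$), $\gamma\in(1,\eta)$ with $\gamma-1$ small, and a constant $K>0$, all independent of $t_*$, $V$ and $\phi$, such that the following holds. Let $t_*>0$ and $0<\alpha\le\alpha_0$, let $V\in C^1(\mathcal{R}^{\sigma_1}_\eta(t_* ))$ satisfy $$C^{-1}\le V\le C,\qquad |\nabla V|\le\alpha t_*^{-1},$$ and let $\phi\in C^2(\mathcal{R}^{\sigma_1}_\eta(t_* ))$ be a (real-valued) solution of $$\Box\phi+V|\phi|^{p-1}\phi=0.$$ Then $$\int_{\mathcal{R}^{\sigma_0}_\gamma(t_* )}|\phi|^{p+1}\le K\,t_*\sup_{\eta^{-1}t_*<\tau<\eta t_*}\int_{\mathcal{A}^{\sigma_0,\sigma_1}(\tau)}\left(|\nabla\phi|^2+|\phi|^{p+1}+t_*^{-2}|\phi|^2\right).$$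
   Context: $\Box:=-\partial_t^2+\Delta_x$ is the wave operator on $\mathbb{R}^{n+1}=\mathbb{R}_t\times\mathbb{R}^n_x$. For a $C^1$ function $\phi$, $|\nabla\phi|^2:=(\partial_t\phi)^2+\sum_{i=1}^n(\partial_{x^i}\phi)^2$. For $n=1$, $\frac{4}{n-1}$ is read as $+\infty$. For $0<\sigma<1$, $\mathcal{C}^\sigma:=\{(t,x)\mid |x|<\sigma t\}$. For $t_*>0$ and $\gamma>1$, $\mathcal{R}^\sigma_\gamma(t_* ):=\{\gamma^{-1}t_*<t<\gamma t_*\}\cap\mathcal{C}^\sigma$; integrals over it are with respect to Lebesgue measure on $\mathbb{R}^{n+1}$. For $\tau\in\mathbb{R}$, $\mathcal{A}^{\sigma_0,\sigma_1}(\tau):=\{(\tau,x)\mid \sigma_0|\tau|<|x|<\sigma_1|\tau|\}$; integrals over it are with respect to $n$-dimensional Lebesgue measure in $x$. The right-hand side is allowed to be $+\infty$. The constants $\alpha_0,\gamma,K$ may depend on $n,p,\sigma_0,\sigma_1,\eta,C$. *)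

theory Defs
  imports "HOL-Analysis.Analysis"
begin

text \<open>Points of space-time are pairs (t, x) in \<^typ>\<open>real \<times> (real ^ 'n)\<close>, so the space dimension n is
  \<^term>\<open>CARD('n)\<close>.\<close>

text \<open>Continuous differentiability of order k on an \<^emph>\<open>open\<close> set U; only the values of f on U matter.\<close>

primrec C_diff_on :: "nat \<Rightarrow> 'a::real_normed_vector set \<Rightarrow> ('a \<Rightarrow> real) \<Rightarrow> bool" where
  "C_diff_on 0 U f \<longleftrightarrow> continuous_on U f"
| "C_diff_on (Suc k) U f \<longleftrightarrow>
     (\<forall>z\<in>U. f differentiable (at z)) \<and>
     (\<forall>v. C_diff_on k U (\<lambda>z. frechet_derivative f (at z) v))"

definition partial_t :: "(real \<times> (real ^ 'n) \<Rightarrow> real) \<Rightarrow> real \<times> (real ^ 'n) \<Rightarrow> real" where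
  "partial_t f z = frechet_derivative f (at z) (1, 0)"

definition partial_x :: "'n \<Rightarrow> (real \<times> (real ^ 'n) \<Rightarrow> real) \<Rightarrow> real \<times> (real ^ 'n) \<Rightarrow> real" where
  "partial_x i f z = frechet_derivative f (at z) (0, axis i 1)"

definition wave_op :: "(real \<times> (real ^ 'n) \<Rightarrow> real) \<Rightarrow> real \<times> (real ^ 'n) \<Rightarrow> real" where
  "wave_op f z = - partial_t (partial_t f) z + (\<Sum>i\<in>UNIV. partial_x i (partial_x i f) z)"

definition grad_norm :: "(real \<times> (real ^ 'n) \<Rightarrow> real) \<Rightarrow> real \<times> (real ^ 'n) \<Rightarrow> real" where
  "grad_norm f z = sqrt ((partial_t f z)\<^sup>2 + (\<Sum>i\<in>UNIV. (partial_x i f z)\<^sup>2))"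

definition cone :: "real \<Rightarrow> (real \<times> (real ^ 'n)) set" where
  "cone \<sigma> = {(t, x). norm x < \<sigma> * t}"

definition cone_slab :: "real \<Rightarrow> real \<Rightarrow> real \<Rightarrow> (real \<times> (real ^ 'n)) set" where
  "cone_slab \<sigma> \<gamma> t0 = {(t, x). inverse \<gamma> * t0 < t \<and> t < \<gamma> * t0} \<inter> cone \<sigma>"

definition annulus :: "real \<Rightarrow> real \<Rightarrow> real \<Rightarrow> (real \<times> (real ^ 'n)) set" where
  "annulus \<sigma>0 \<sigma>1 \<tau> = {(t, x). t = \<tau> \<and> \<sigma>0 * \<bar>\<tau>\<bar> < norm x \<and> norm x < \<sigma>1 * \<bar>\<tau>\<bar>}"

end

theory Submission imports Defs begin

text \<open>Choose a vertex \<open>z0 = (t0, \<sigma>1 t0 e)\<close> on the outer cone and let \<open>f\<close> be the Minkowski square of \<open>z - z0\<close>,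
  positive where \<open>z - z0\<close> is spacelike. Contracting the energy-momentum tensor with the scaling field
  \<open>z - z0\<close> weighted by \<open>f powr a\<close>, plus lower-order corrections, gives a vector field whose divergence is
  a square plus a multiple of \<open>f powr a * \<bar>\<phi>\<bar> powr (p + 1)\<close>; the multiple is positive for small
  \<open>a > 0\<close> exactly because \<open>p\<close> is subconformal and \<open>V\<close> varies slowly. The flux through \<open>f = 0\<close> vanishes
  since \<open>a > 0\<close>, and a lateral cutoff produces errors only in the annular region, so no interior boundary term
  survives. Since \<open>z0\<close> is spacelike to a neighbourhood of the slice \<open>t = t0\<close> of the inner cone, the weight
  is comparable to \<open>t0 powr (2 * a)\<close> there.\<close>

section \<open>Divergence of continuously differentiable vector fields\<close>

text \<open>With n = \<open>CARD('n)\<close> and a = 0 the multiplier is the scaling derivative plus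
  (n - 1) / 2 times \<phi>, and the bulk coefficient of V |\<phi>|^(p+1) / (p+1) is c0 = n + 1 - (p
  + 1)(n - 1) / 2, positive exactly below the conformal power 1 + 4 / (n - 1). Taking a > 0 costs
  only a (p - 1) of c0 and removes the flux through f = 0 without any discussion of its sign. The
  price is a set of terms of order f^(a-1). One is a square with a favourable sign and is dropped.
  The cutoff, however, produces further terms f^(a-1) \<phi>^2 without sign in the annular region,
  which touches f = 0; for a < 1 their weight is unbounded there, so the annular integral cannot
  absorb them. They have to cancel identically, and the surviving errors carry the bounded weight
  f^a.

  The part of the thickened inner cone where f \<ge> 0 is compact because the slopes are below 1,
  but its times may range from (1 - \<sigma>1) / 4 to 3 / (1 - \<sigma>1) times t0; this is why
  \<eta> has to be large. All constants are scale invariant, so they do not depend on t0.\<close>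

definition C1_deriv :: "'a::real_normed_vector set \<Rightarrow> ('a \<Rightarrow> 'b::real_normed_vector) \<Rightarrow> ('a \<Rightarrow> 'a \<Rightarrow> 'b) \<Rightarrow> bool" where
  "C1_deriv \<Omega> f f' \<longleftrightarrow>
     (\<forall>z\<in>\<Omega>. (f has_derivative f' z) (at z)) \<and> (\<forall>h. continuous_on \<Omega> (\<lambda>z. f' z h))"

text \<open>The derivative family in \<open>C1_deriv\<close> is explicit and continuous direction by
  direction, which in finite dimension is full continuity; product rules then yield formulas
  directly, without a topology on linear maps. The divergence is the trace of that family, stated as
  a relation so that it can be rewritten on \<Omega> alone.\<close>

definition C1_div :: "'a::euclidean_space set \<Rightarrow> ('a \<Rightarrow> 'a) \<Rightarrow> ('a \<Rightarrow> real) \<Rightarrow> bool" where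
  "C1_div \<Omega> X d \<longleftrightarrow>
     (\<exists>X'. C1_deriv \<Omega> X X' \<and> (\<forall>z\<in>\<Omega>. d z = (\<Sum>e\<in>Basis. X' z e \<bullet> e)))"

lemma C1_deriv_subset: "C1_deriv \<Omega> f f' \<Longrightarrow> \<Omega>' \<subseteq> \<Omega> \<Longrightarrow> C1_deriv \<Omega>' f f'"
  unfolding C1_deriv_def by (blast intro: continuous_on_subset)

lemma C1_div_subset: "C1_div \<Omega> X d \<Longrightarrow> \<Omega>' \<subseteq> \<Omega> \<Longrightarrow> C1_div \<Omega>' X d"
  unfolding C1_div_def by (blast intro: C1_deriv_subset)

lemma C1_deriv_cont: "C1_deriv \<Omega> f f' \<Longrightarrow> continuous_on \<Omega> f"
  unfolding C1_deriv_def
  by (auto intro!: continuous_at_imp_continuous_on has_derivative_continuous)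

lemma C1_deriv_cong:
  "C1_deriv \<Omega> f f' \<Longrightarrow> (\<And>z h. f' z h = g' z h) \<Longrightarrow> C1_deriv \<Omega> f g'"
  by (subgoal_tac "f' = g'") (auto simp: fun_eq_iff)

lemma C1_deriv_const: "C1_deriv \<Omega> (\<lambda>_. c) (\<lambda>_ _. 0)"
  by (simp add: C1_deriv_def)

lemma C1_deriv_bounded_linear: "bounded_linear L \<Longrightarrow> C1_deriv \<Omega> L (\<lambda>_. L)"
  by (simp add: C1_deriv_def bounded_linear_imp_has_derivative)

lemma C1_deriv_linear_comp:
  "bounded_linear L \<Longrightarrow> C1_deriv \<Omega> f f' \<Longrightarrow> C1_deriv \<Omega> (\<lambda>z. L (f z)) (\<lambda>z h. L (f' z h))"
  unfolding C1_deriv_def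
  by (auto intro: bounded_linear.has_derivative bounded_linear.continuous_on)

lemma C1_deriv_add:
  "C1_deriv \<Omega> f f' \<Longrightarrow> C1_deriv \<Omega> g g' \<Longrightarrow> C1_deriv \<Omega> (\<lambda>z. f z + g z) (\<lambda>z h. f' z h + g' z h)"
  unfolding C1_deriv_def by (auto intro!: derivative_intros continuous_intros)

lemma C1_deriv_diff:
  "C1_deriv \<Omega> f f' \<Longrightarrow> C1_deriv \<Omega> g g' \<Longrightarrow> C1_deriv \<Omega> (\<lambda>z. f z - g z) (\<lambda>z h. f' z h - g' z h)"
  unfolding C1_deriv_def by (auto intro!: derivative_intros continuous_intros)

lemma C1_deriv_shift: "C1_deriv \<Omega> (\<lambda>z. z - c) (\<lambda>z h. h)"
  by (rule C1_deriv_cong[OF C1_deriv_diff[OF C1_deriv_bounded_linear[OF bounded_linear_ident] C1_deriv_const]]) simp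

lemma C1_deriv_bilinear:
  assumes "bounded_bilinear p" "C1_deriv \<Omega> f f'" "C1_deriv \<Omega> g g'"
  shows "C1_deriv \<Omega> (\<lambda>z. p (f z) (g z)) (\<lambda>z h. p (f z) (g' z h) + p (f' z h) (g z))"
proof -
  have "continuous_on \<Omega> f" "continuous_on \<Omega> g"
    using assms C1_deriv_cont by blast+
  then have "continuous_on \<Omega> (\<lambda>z. p (f z) (g' z h) + p (f' z h) (g z))" for h
    using assms by (intro continuous_on_add bounded_bilinear.continuous_on[OF assms(1)])
      (auto simp: C1_deriv_def)
  moreover have "((\<lambda>z. p (f z) (g z)) has_derivative (\<lambda>h. p (f z) (g' z h) + p (f' z h) (g z))) (at z)"
    if "z \<in> \<Omega>" for z
    by (rule bounded_bilinear.FDERIV[OF assms(1)]) (use assms that in \<open>auto simp: C1_deriv_def\<close>)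
  ultimately show ?thesis
    by (simp add: C1_deriv_def)
qed

lemmas C1_deriv_mult = C1_deriv_bilinear[OF bounded_bilinear_mult]
lemmas C1_deriv_scaleR = C1_deriv_bilinear[OF bounded_bilinear_scaleR]
lemmas C1_deriv_inner = C1_deriv_bilinear[OF bounded_bilinear_inner]

lemma C1_deriv_real_comp:
  fixes f :: "'a::real_normed_vector \<Rightarrow> real" and g g' :: "real \<Rightarrow> real"
  assumes "C1_deriv \<Omega> f f'" "\<And>z. z \<in> \<Omega> \<Longrightarrow> (g has_real_derivative g' (f z)) (at (f z))"
    "continuous_on (f ` \<Omega>) g'"
  shows "C1_deriv \<Omega> (\<lambda>z. g (f z)) (\<lambda>z h. g' (f z) * f' z h)"
  unfolding C1_deriv_def
proof (intro conjI ballI allI)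
  fix z assume z: "z \<in> \<Omega>"
  have "(f has_derivative f' z) (at z)" using assms z by (auto simp: C1_deriv_def)
  from DERIV_compose_FDERIV[OF assms(2)[OF z] this]
  show "((\<lambda>z. g (f z)) has_derivative (\<lambda>h. g' (f z) * f' z h)) (at z)"
    by (simp add: mult.commute)
next
  fix h
  have "continuous_on \<Omega> (\<lambda>z. g' (f z))"
    using continuous_on_compose2[OF assms(3) C1_deriv_cont[OF assms(1)]] by simp
  then show "continuous_on \<Omega> (\<lambda>z. g' (f z) * f' z h)"
    using assms(1) by (auto simp: C1_deriv_def intro!: continuous_intros)
qed

lemma C1_div_cont: "C1_div \<Omega> X d \<Longrightarrow> continuous_on \<Omega> d"
proof -
  assume "C1_div \<Omega> X d"
  then obtain X' where X': "C1_deriv \<Omega> X X'" "\<And>z. z\<in>\<Omega> \<Longrightarrow> d z = (\<Sum>e\<in>Basis. X' z e \<bullet> e)"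
    by (auto simp: C1_div_def)
  have "continuous_on \<Omega> (\<lambda>z. \<Sum>e\<in>Basis. X' z e \<bullet> e)"
    using X'(1) by (auto simp: C1_deriv_def intro!: continuous_intros)
  then show ?thesis using X'(2) by (simp cong: continuous_on_cong)
qed

lemma C1_div_cong:
  "C1_div \<Omega> X d \<Longrightarrow> (\<And>z. z \<in> \<Omega> \<Longrightarrow> d z = d' z) \<Longrightarrow> C1_div \<Omega> X d'"
  by (auto simp: C1_div_def)

lemma C1_div_add:
  assumes "C1_div \<Omega> X d" "C1_div \<Omega> Y d'"
  shows "C1_div \<Omega> (\<lambda>z. X z + Y z) (\<lambda>z. d z + d' z)"
proof -
  obtain X' Y' where X: "C1_deriv \<Omega> X X'" "\<forall>z\<in>\<Omega>. d z = (\<Sum>e\<in>Basis. X' z e \<bullet> e)"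
    and Y: "C1_deriv \<Omega> Y Y'" "\<forall>z\<in>\<Omega>. d' z = (\<Sum>e\<in>Basis. Y' z e \<bullet> e)"
    using assms by (auto simp: C1_div_def)
  have "\<forall>z\<in>\<Omega>. d z + d' z = (\<Sum>e\<in>Basis. (X' z e + Y' z e) \<bullet> e)"
    using X(2) Y(2) by (simp add: inner_add_left sum.distrib)
  with C1_deriv_add[OF X(1) Y(1)] show ?thesis unfolding C1_div_def by blast
qed

lemma C1_div_scaleR:
  assumes k: "C1_deriv \<Omega> k k'" and X: "C1_div \<Omega> X d"
  shows "C1_div \<Omega> (\<lambda>z. k z *\<^sub>R X z) (\<lambda>z. k' z (X z) + k z * d z)"
proof -
  obtain X' where X': "C1_deriv \<Omega> X X'" "\<forall>z\<in>\<Omega>. d z = (\<Sum>e\<in>Basis. X' z e \<bullet> e)"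
    using X by (auto simp: C1_div_def)
  have "(\<Sum>e\<in>Basis. k' z e * (X z \<bullet> e)) = k' z (X z)" if "z \<in> \<Omega>" for z
  proof -
    have "linear (k' z)" using k that by (auto simp: C1_deriv_def dest: has_derivative_linear)
    then have "k' z (\<Sum>e\<in>Basis. (X z \<bullet> e) *\<^sub>R e) = (\<Sum>e\<in>Basis. k' z e * (X z \<bullet> e))"
      by (simp add: linear_sum linear_scale mult.commute)
    then show ?thesis by (simp add: euclidean_representation)
  qed
  then have "\<forall>z\<in>\<Omega>. k' z (X z) + k z * d z = (\<Sum>e\<in>Basis. (k z *\<^sub>R X' z e + k' z e *\<^sub>R X z) \<bullet> e)"
    using X'(2) by (simp add: inner_add_left sum.distrib sum_distrib_left)
  with C1_deriv_scaleR[OF k X'(1)] show ?thesis unfolding C1_div_def by blast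
qed

text \<open>Lebesgue measure is translation invariant, so every difference quotient of
  \<open>g\<close> along \<open>v\<close> has integral zero; dominated convergence passes this on to
  the derivative.\<close>

lemma has_bochner_integral_directional_deriv:
  fixes g :: "'a::euclidean_space \<Rightarrow> real"
  assumes g: "\<And>z. (g has_derivative g' z) (at z)"
    and cont: "continuous_on UNIV (\<lambda>z. g' z v)"
    and K: "compact K" "\<And>z. z \<notin> K \<Longrightarrow> g z = 0"
  shows "has_bochner_integral lborel (\<lambda>z. g' z v) 0"
proof -
  \<comment> \<open>\<open>K\<close> swept backwards along \<open>v\<close> for steps up to 1: this
    contains the support of every difference quotient \<open>F n\<close> below.\<close>
  define K2 where "K2 = (\<lambda>(z, r). z - r *\<^sub>R v) ` (K \<times> {0..1::real})"
  have K2: "compact K2" unfolding K2_def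
    by (intro compact_continuous_image compact_Times K)
      (auto simp: case_prod_unfold intro!: continuous_intros)
  have KK2: "K \<subseteq> K2" unfolding K2_def by force
  have gc: "continuous_on UNIV g"
    using g by (meson continuous_at_imp_continuous_on has_derivative_continuous)
  have "integrable lborel (\<lambda>z. indicator K z *\<^sub>R g z)"
    using K gc by (intro borel_integrable_compact) (auto intro: continuous_on_subset)
  moreover have "(\<lambda>z. indicator K z *\<^sub>R g z) = g" using K by (auto simp: fun_eq_iff indicator_def)
  ultimately have gi: "integrable lborel g" by simp
  have shift: "integrable lborel (\<lambda>z. g (c + z)) \<and> integral\<^sup>L lborel (\<lambda>z. g (c + z)) = integral\<^sup>L lborel g" for c
  proof -
    have "integrable (distr lborel borel ((+) c)) g" using gi by (simp add: lborel_distr_plus)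
    then have 1: "integrable lborel (\<lambda>z. g (c + z))" by (rule integrable_distr[rotated]) simp
    have "integral\<^sup>L (distr lborel borel ((+) c)) g = integral\<^sup>L lborel (\<lambda>z. g (c + z))"
      using gc by (intro integral_distr) (auto intro: borel_measurable_continuous_onI)
    with 1 show ?thesis by (simp add: lborel_distr_plus)
  qed
  have "compact ((\<lambda>z. g' z v) ` K2)" using K2 cont
    by (intro compact_continuous_image) (auto intro: continuous_on_subset)
  then obtain M where "\<forall>x\<in>(\<lambda>z. g' z v) ` K2. norm x \<le> M"
    using compact_imp_bounded bounded_iff by blast
  then have M: "\<And>z. z \<in> K2 \<Longrightarrow> \<bar>g' z v\<bar> \<le> M" by simp
  have lin: "linear (g' z)" for z using g has_derivative_linear by blast
  have ray: "((\<lambda>r. g (z + r *\<^sub>R v)) has_real_derivative g' (z + r *\<^sub>R v) v) (at r)" for z r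
  proof -
    have "((\<lambda>r. g (z + r *\<^sub>R v)) has_derivative (\<lambda>x. g' (z + r *\<^sub>R v) (x *\<^sub>R v))) (at r)"
      by (rule has_derivative_compose[OF _ g]) (auto intro!: derivative_eq_intros)
    then show ?thesis by (simp add: has_field_derivative_def linear_scale[OF lin] mult.commute[of _ "g' _ v"])
  qed
  define F where "F n z = real (Suc n) * (g (inverse (real (Suc n)) *\<^sub>R v + z) - g z)" for n z
  have lim: "(\<lambda>n. F n z) \<longlonglongrightarrow> g' z v" for z
  proof -
    have "((\<lambda>h. (g (z + h *\<^sub>R v) - g z) / h) \<longlongrightarrow> g' z v) (at 0)"
      using ray[of z 0] by (simp add: DERIV_def)
    moreover have "filterlim (\<lambda>n. inverse (real (Suc n))) (at 0) sequentially"
      by (auto simp: filterlim_at LIMSEQ_inverse_real_of_nat simp del: of_nat_Suc)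
    ultimately have "(\<lambda>n. (g (z + inverse (real (Suc n)) *\<^sub>R v) - g z) / inverse (real (Suc n))) \<longlonglongrightarrow> g' z v"
      by (rule filterlim_compose)
    then show ?thesis by (simp add: F_def field_simps)
  qed
  \<comment> \<open>By the mean value theorem the quotient is a derivative at an intermediate point;
    if that point has left \<open>K2\<close>, then \<open>g\<close> vanishes around it and so does
    the derivative.\<close>
  have bnd: "\<bar>F n z\<bar> \<le> indicator K2 z * M" for n z
  proof (cases "z \<in> K2")
    case False
    have "inverse (real (Suc n)) *\<^sub>R v + z \<notin> K"
    proof
      assume *: "inverse (real (Suc n)) *\<^sub>R v + z \<in> K"
      have "z \<in> K2" unfolding K2_def
        by (rule image_eqI[of _ _ "(inverse (real (Suc n)) *\<^sub>R v + z, inverse (real (Suc n)))"])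
          (use * in \<open>auto simp: field_simps\<close>)
      with False show False by simp
    qed
    then show ?thesis using False KK2 K by (auto simp: F_def)
  next
    case True
    define i where "i = inverse (real (Suc n))"
    have i: "0 < i" "i \<le> 1" by (auto simp: i_def field_simps)
    from MVT2[OF i(1), of "\<lambda>r. g (z + r *\<^sub>R v)" "\<lambda>r. g' (z + r *\<^sub>R v) v"] ray
    obtain r where r: "0 < r" "r < i" "g (z + i *\<^sub>R v) - g z = i * g' (z + r *\<^sub>R v) v" by auto
    have "F n z = (g (z + i *\<^sub>R v) - g z) / i" by (simp add: F_def i_def field_simps)
    also have "\<dots> = g' (z + r *\<^sub>R v) v" using r i by simp
    finally have F: "F n z = g' (z + r *\<^sub>R v) v" .
    show ?thesis
    proof (cases "z + r *\<^sub>R v \<in> K2")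
      case True
      then show ?thesis using M F \<open>z \<in> K2\<close> by simp
    next
      case False
      have "(g has_derivative (\<lambda>_. 0)) (at (z + r *\<^sub>R v))"
        by (rule has_derivative_transform_within_open[of "\<lambda>_. 0" _ _ UNIV "- K"])
          (use False KK2 K in \<open>auto intro!: compact_imp_closed open_Compl\<close>)
      then have "g' (z + r *\<^sub>R v) = (\<lambda>_. 0)" using g has_derivative_unique by blast
      then show ?thesis using F M[OF \<open>z \<in> K2\<close>] \<open>z \<in> K2\<close> by simp
    qed
  qed
  have Fi: "integral\<^sup>L lborel (F n) = 0" for n
    unfolding F_def using shift[of "inverse (real (Suc n)) *\<^sub>R v"] gi by (simp del: of_nat_Suc)
  have Fm: "F n \<in> borel_measurable lborel" for n
    unfolding F_def using gi shift by (intro borel_measurable_times borel_measurable_diff) auto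
  have gm: "(\<lambda>z. g' z v) \<in> borel_measurable lborel"
    using cont by (simp add: borel_measurable_continuous_onI)
  have wi: "integrable lborel (\<lambda>z. indicator K2 z * M)"
    using K2 by (auto intro!: emeasure_compact_finite borel_compact integrable_mult_left)
  have "integrable lborel (\<lambda>z. g' z v)"
    by (rule integrable_dominated_convergence[where s = F, OF gm Fm wi]) (use lim bnd in auto)
  moreover have "(\<lambda>n. integral\<^sup>L lborel (F n)) \<longlonglongrightarrow> integral\<^sup>L lborel (\<lambda>z. g' z v)"
    by (rule integral_dominated_convergence[where s = F, OF gm Fm wi]) (use lim bnd in auto)
  ultimately show ?thesis by (simp add: Fi LIMSEQ_const_iff has_bochner_integral_iff)
qed

text \<open>\<open>X\<close> vanishes off \<open>K\<close>, so extending its derivative by 0 makes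
  it continuously differentiable on the whole space, which is covered by the open sets \<Omega> and
  \<open>- K\<close>. The vanishing of \<open>d\<close> off \<open>K\<close> is exported for
  arguments that compare integrands pointwise.\<close>

lemma integral_divergence:
  fixes X :: "'a::euclidean_space \<Rightarrow> 'a"
  assumes X: "C1_div \<Omega> X d" and \<Omega>: "open \<Omega>" and K: "compact K" "K \<subseteq> \<Omega>"
    and zero: "\<And>z. z \<notin> K \<Longrightarrow> X z = 0"
  shows "has_bochner_integral lborel (\<lambda>z. indicator \<Omega> z * d z) 0"
    and "\<And>z. z \<in> \<Omega> - K \<Longrightarrow> d z = 0"
proof -
  obtain X' where X': "C1_deriv \<Omega> X X'" and d: "\<And>z. z\<in>\<Omega> \<Longrightarrow> d z = (\<Sum>e\<in>Basis. X' z e \<bullet> e)"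
    using X by (auto simp: C1_div_def)
  have opK: "open (- K)" using K by (simp add: compact_imp_closed open_Compl)
  have d0: "(X has_derivative (\<lambda>_. 0)) (at z)" if "z \<notin> K" for z
    by (rule has_derivative_transform_within_open[of "\<lambda>_. 0" _ _ UNIV "- K"])
      (use that opK zero in auto)
  have X'0: "X' z = (\<lambda>_. 0)" if "z \<in> \<Omega> - K" for z
    using d0 X' that by (auto simp: C1_deriv_def intro: has_derivative_unique)
  then show "d z = 0" if "z \<in> \<Omega> - K" for z using d that by auto
  define D where "D z = (if z \<in> \<Omega> then X' z else (\<lambda>_. 0))" for z
  have D: "(X has_derivative D z) (at z)" for z
    using d0[of z] X' K by (auto simp: D_def C1_deriv_def)
  have Dc: "continuous_on UNIV (\<lambda>z. D z h)" for h
  proof -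
    have "continuous_on \<Omega> (\<lambda>z. D z h)"
      using X' by (auto simp: C1_deriv_def D_def cong: continuous_on_cong)
    moreover have "continuous_on (-K) (\<lambda>z. D z h)"
      by (rule continuous_on_eq[of _ "\<lambda>_. 0"]) (auto simp: D_def X'0)
    ultimately have "continuous_on (\<Omega> \<union> - K) (\<lambda>z. D z h)"
      using \<Omega> opK by (intro continuous_on_open_Un)
    moreover have "\<Omega> \<union> - K = UNIV" using K by auto
    ultimately show ?thesis by simp
  qed
  have "has_bochner_integral lborel (\<lambda>z. D z e \<bullet> e) 0" for e
  proof (rule has_bochner_integral_directional_deriv[where K = K and g = "\<lambda>z. X z \<bullet> e" and g' = "\<lambda>z h. D z h \<bullet> e"])
    show "((\<lambda>z. X z \<bullet> e) has_derivative (\<lambda>h. D z h \<bullet> e)) (at z)" for z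
      using D by (auto intro!: derivative_eq_intros)
  qed (use Dc K zero in \<open>auto intro!: continuous_intros\<close>)
  then have "has_bochner_integral lborel (\<lambda>z. \<Sum>e\<in>Basis. D z e \<bullet> e) (\<Sum>e\<in>(Basis::'a set). 0)"
    by (rule has_bochner_integral_sum)
  moreover have "(\<lambda>z. \<Sum>e\<in>Basis. D z e \<bullet> e) = (\<lambda>z. indicator \<Omega> z * d z)"
    by (auto simp: D_def fun_eq_iff d indicator_def)
  ultimately show "has_bochner_integral lborel (\<lambda>z. indicator \<Omega> z * d z) 0" by simp
qed

text \<open>The mixed second difference is symmetric in the two directions, and the mean value
  theorem, applied in either order, expresses it through a nearby value of one of the mixed
  derivatives; continuity of \<open>H\<close> does the rest.\<close>

lemma second_derivative_symmetric:
  fixes \<phi> :: "'a::euclidean_space \<Rightarrow> real"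
  assumes \<Omega>: "open \<Omega>" and \<phi>: "C1_deriv \<Omega> \<phi> (\<lambda>z h. G z \<bullet> h)" and G: "C1_deriv \<Omega> G H" and z: "z \<in> \<Omega>"
  shows "H z u \<bullet> v = H z v \<bullet> u"
proof -
  obtain r0 where r0: "r0 > 0" "ball z r0 \<subseteq> \<Omega>" using \<Omega> z openE by blast
  \<comment> \<open>The extra 1 keeps \<open>m\<close> positive when both vectors vanish, and makes
    \<open>norm u + norm v < m\<close> strict.\<close>
  define m where "m = norm u + norm v + 1"
  have m: "m > 0" by (simp add: m_def add_nonneg_pos)
  have key: "\<exists>s s'. 0 < s \<and> s < r \<and> 0 < s' \<and> s' < r \<and>
      \<phi> (z + r *\<^sub>R u + r *\<^sub>R v) - \<phi> (z + r *\<^sub>R u) - \<phi> (z + r *\<^sub>R v) + \<phi> z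
        = r * r * (H (z + s *\<^sub>R u + s' *\<^sub>R v) v \<bullet> u)"
    if r: "0 < r" "r * m < r0" and m: "norm u + norm v < m" for r u v
  proof -
    have mem: "z + s *\<^sub>R u + s' *\<^sub>R v \<in> \<Omega>" if "0 \<le> s" "s \<le> r" "0 \<le> s'" "s' \<le> r" for s s'
    proof -
      have "norm (s *\<^sub>R u + s' *\<^sub>R v) \<le> s * norm u + s' * norm v"
        using norm_triangle_ineq[of "s *\<^sub>R u" "s' *\<^sub>R v"] that by simp
      also have "\<dots> \<le> r * norm u + r * norm v"
        using that by (intro add_mono mult_right_mono) auto
      also have "\<dots> = r * (norm u + norm v)" by (simp add: algebra_simps)
      also have "\<dots> < r0" using mult_strict_left_mono[OF m r(1)] r by linarith
      finally have "z + (s *\<^sub>R u + s' *\<^sub>R v) \<in> ball z r0"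
        by (metis add_diff_cancel_left' dist_commute dist_norm mem_ball)
      then show ?thesis using r0 by (auto simp: add.assoc)
    qed
    have d1: "((\<lambda>s. \<phi> (z + s *\<^sub>R u + s' *\<^sub>R v)) has_real_derivative G (z + s *\<^sub>R u + s' *\<^sub>R v) \<bullet> u) (at s)"
      if "0 \<le> s" "s \<le> r" "0 \<le> s'" "s' \<le> r" for s s'
    proof -
      have "(\<phi> has_derivative (\<lambda>h. G (z + s *\<^sub>R u + s' *\<^sub>R v) \<bullet> h)) (at (z + s *\<^sub>R u + s' *\<^sub>R v))"
        using \<phi> mem[OF that] by (auto simp: C1_deriv_def)
      then have "((\<lambda>s. \<phi> (z + s *\<^sub>R u + s' *\<^sub>R v)) has_derivative (\<lambda>x. G (z + s *\<^sub>R u + s' *\<^sub>R v) \<bullet> (x *\<^sub>R u))) (at s)"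
        by (rule has_derivative_compose[of "\<lambda>s. z + s *\<^sub>R u + s' *\<^sub>R v" "\<lambda>x. x *\<^sub>R u", rotated])
          (auto intro!: derivative_eq_intros)
      then show ?thesis by (simp add: has_field_derivative_def mult.commute[of _ "G _ \<bullet> u"])
    qed
    have d2: "((\<lambda>s'. G (z + s *\<^sub>R u + s' *\<^sub>R v) \<bullet> u) has_real_derivative H (z + s *\<^sub>R u + s' *\<^sub>R v) v \<bullet> u) (at s')"
      if "0 \<le> s" "s \<le> r" "0 \<le> s'" "s' \<le> r" for s s'
    proof -
      have *: "(G has_derivative H (z + s *\<^sub>R u + s' *\<^sub>R v)) (at (z + s *\<^sub>R u + s' *\<^sub>R v))"
        using G mem[OF that] by (auto simp: C1_deriv_def)
      then have "((\<lambda>s'. G (z + s *\<^sub>R u + s' *\<^sub>R v)) has_derivative (\<lambda>x. H (z + s *\<^sub>R u + s' *\<^sub>R v) (x *\<^sub>R v))) (at s')"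
        by (rule has_derivative_compose[of "\<lambda>s'. z + s *\<^sub>R u + s' *\<^sub>R v" "\<lambda>x. x *\<^sub>R v", rotated])
          (auto intro!: derivative_eq_intros)
      then have "((\<lambda>s'. G (z + s *\<^sub>R u + s' *\<^sub>R v) \<bullet> u) has_derivative (\<lambda>x. H (z + s *\<^sub>R u + s' *\<^sub>R v) (x *\<^sub>R v) \<bullet> u)) (at s')"
        by (auto intro!: derivative_eq_intros)
      then show ?thesis
        by (simp add: has_field_derivative_def mult.commute[of _ "H _ v \<bullet> u"] linear_scale[OF has_derivative_linear[OF *]])
    qed
    have "\<exists>s>0. s < r \<and> (\<phi> (z + r *\<^sub>R u + r *\<^sub>R v) - \<phi> (z + r *\<^sub>R u + 0 *\<^sub>R v))
        - (\<phi> (z + 0 *\<^sub>R u + r *\<^sub>R v) - \<phi> (z + 0 *\<^sub>R u + 0 *\<^sub>R v)) =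
       (r - 0) * (G (z + s *\<^sub>R u + r *\<^sub>R v) \<bullet> u - G (z + s *\<^sub>R u + 0 *\<^sub>R v) \<bullet> u)"
      using r by (intro MVT2[of 0 r "\<lambda>s. \<phi> (z + s *\<^sub>R u + r *\<^sub>R v) - \<phi> (z + s *\<^sub>R u + 0 *\<^sub>R v)"]) (auto intro!: DERIV_diff d1 simp del: scale_zero_left)
    then obtain s where s: "0 < s" "s < r" "\<phi> (z + r *\<^sub>R u + r *\<^sub>R v) - \<phi> (z + r *\<^sub>R u) - \<phi> (z + r *\<^sub>R v) + \<phi> z =
       r * (G (z + s *\<^sub>R u + r *\<^sub>R v) \<bullet> u - G (z + s *\<^sub>R u + 0 *\<^sub>R v) \<bullet> u)" by auto
    have "\<exists>s'>0. s' < r \<and> G (z + s *\<^sub>R u + r *\<^sub>R v) \<bullet> u - G (z + s *\<^sub>R u + 0 *\<^sub>R v) \<bullet> u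
      = (r - 0) * (H (z + s *\<^sub>R u + s' *\<^sub>R v) v \<bullet> u)"
      using r s by (intro MVT2[of 0 r "\<lambda>s'. G (z + s *\<^sub>R u + s' *\<^sub>R v) \<bullet> u"]) (auto intro!: d2)
    then show ?thesis using s by (auto simp: mult.assoc)
  qed
  have cont: "isCont (\<lambda>w. H w a \<bullet> b) z" for a b
  proof -
    have "continuous_on \<Omega> (\<lambda>w. H w a \<bullet> b)" using G by (auto simp: C1_deriv_def intro!: continuous_intros)
    then show ?thesis using \<Omega> z continuous_on_eq_continuous_at by blast
  qed
  define i where "i n = inverse (real (Suc n)) * (r0 / m)" for n
  have i: "0 < i n" "i n * m = r0 / real (Suc n)" for n
    using m r0 by (auto simp: i_def divide_inverse)
  have ilim: "i \<longlonglongrightarrow> 0" unfolding i_def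
    using tendsto_mult_right[OF LIMSEQ_inverse_real_of_nat, of "r0 / m"] by (simp del: of_nat_Suc)
  have "\<exists>s s' t t'. 0 < s \<and> s < i (Suc n) \<and> 0 < s' \<and> s' < i (Suc n) \<and> 0 < t \<and> t < i (Suc n) \<and> 0 < t' \<and> t' < i (Suc n) \<and>
     H (z + s *\<^sub>R u + s' *\<^sub>R v) v \<bullet> u = H (z + t *\<^sub>R v + t' *\<^sub>R u) u \<bullet> v" for n
  proof -
    \<comment> \<open>\<open>i 0 * m\<close> equals \<open>r0\<close>; the shifted index makes the
      inequality strict.\<close>
    have *: "i (Suc n) * m < r0" using r0 unfolding i(2) by (simp add: field_simps add_pos_nonneg)
    from key[OF i(1) *, of u v] key[OF i(1) *, of v u]
    obtain s s' t t' where
      s: "0 < s" "s < i (Suc n)" "0 < s'" "s' < i (Suc n)" "0 < t" "t < i (Suc n)" "0 < t'" "t' < i (Suc n)"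
      and e: "\<phi> (z + i (Suc n) *\<^sub>R u + i (Suc n) *\<^sub>R v) - \<phi> (z + i (Suc n) *\<^sub>R u) - \<phi> (z + i (Suc n) *\<^sub>R v) + \<phi> z
        = i (Suc n) * i (Suc n) * (H (z + s *\<^sub>R u + s' *\<^sub>R v) v \<bullet> u)"
        "\<phi> (z + i (Suc n) *\<^sub>R v + i (Suc n) *\<^sub>R u) - \<phi> (z + i (Suc n) *\<^sub>R v) - \<phi> (z + i (Suc n) *\<^sub>R u) + \<phi> z
        = i (Suc n) * i (Suc n) * (H (z + t *\<^sub>R v + t' *\<^sub>R u) u \<bullet> v)"
      by (auto simp: m_def)
    have "i (Suc n) * i (Suc n) * (H (z + s *\<^sub>R u + s' *\<^sub>R v) v \<bullet> u) = i (Suc n) * i (Suc n) * (H (z + t *\<^sub>R v + t' *\<^sub>R u) u \<bullet> v)"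
      using e by (simp add: algebra_simps)
    then have "H (z + s *\<^sub>R u + s' *\<^sub>R v) v \<bullet> u = H (z + t *\<^sub>R v + t' *\<^sub>R u) u \<bullet> v"
      using i(1)[of "Suc n"] by (simp only: mult_cancel_left) simp
    with s show ?thesis by blast
  qed
  then obtain s s' t t' where
    s: "\<And>n. 0 < s n" "\<And>n. s n < i (Suc n)" "\<And>n. 0 < s' n" "\<And>n. s' n < i (Suc n)"
       "\<And>n. 0 < t n" "\<And>n. t n < i (Suc n)" "\<And>n. 0 < t' n" "\<And>n. t' n < i (Suc n)"
    and e: "\<And>n. H (z + s n *\<^sub>R u + s' n *\<^sub>R v) v \<bullet> u = H (z + t n *\<^sub>R v + t' n *\<^sub>R u) u \<bullet> v"
    by metis
  have to0: "a \<longlonglongrightarrow> 0" if "\<And>n. 0 < a n" "\<And>n. a n < i (Suc n)" for a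
    by (rule real_tendsto_sandwich[OF _ _ tendsto_const LIMSEQ_Suc[OF ilim]])
      (use that in \<open>auto intro!: always_eventually less_imp_le\<close>)
  have lims: "s \<longlonglongrightarrow> 0" "s' \<longlonglongrightarrow> 0" "t \<longlonglongrightarrow> 0" "t' \<longlonglongrightarrow> 0"
    by (rule to0; rule s)+
  have to_z: "(\<lambda>n. z + a n *\<^sub>R x + b n *\<^sub>R y) \<longlonglongrightarrow> z"
    if "a \<longlonglongrightarrow> 0" "b \<longlonglongrightarrow> 0" for a b :: "nat \<Rightarrow> real" and x y
    using that by (auto intro!: tendsto_eq_intros)
  have L1: "(\<lambda>n. H (z + s n *\<^sub>R u + s' n *\<^sub>R v) v \<bullet> u) \<longlonglongrightarrow> H z v \<bullet> u"
    by (rule isCont_tendsto_compose[OF cont to_z[OF lims(1,2)]])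
  have L2: "(\<lambda>n. H (z + t n *\<^sub>R v + t' n *\<^sub>R u) u \<bullet> v) \<longlonglongrightarrow> H z u \<bullet> v"
    by (rule isCont_tendsto_compose[OF cont to_z[OF lims(3,4)]])
  show ?thesis using LIMSEQ_unique[OF L1] L2 e by simp
qed

section \<open>Powers\<close>

text \<open>Since \<open>0 powr s = 0\<close> for every s, the power alone jumps at 0 for q = 2 (the
  case p = 1) and blows up for q < 2. The factor \<open>r\<close> repairs this: the modulus of the
  product is \<open>\<bar>r\<bar> powr (q - 1)\<close>.\<close>

lemma continuous_on_abs_powr_mult:
  fixes q :: real
  assumes "q > 1"
  shows "continuous_on UNIV (\<lambda>r::real. \<bar>r\<bar> powr (q - 2) * r)"
proof -
  have "isCont (\<lambda>r::real. \<bar>r\<bar> powr (q - 2) * r) x" for x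
  proof (cases "x = 0")
    case False
    then show ?thesis by (intro continuous_intros) auto
  next
    case True
    have "continuous_on UNIV (\<lambda>r::real. \<bar>r\<bar> powr (q - 1))"
      using assms by (intro continuous_on_powr' continuous_intros) auto
    then have "((\<lambda>r::real. \<bar>r\<bar> powr (q - 1)) \<longlongrightarrow> 0) (at 0)"
      by (auto simp: continuous_on_eq_continuous_at isCont_def dest!: spec[of _ 0])
    moreover have "\<bar>r\<bar> powr (q - 1) = \<bar>\<bar>r\<bar> powr (q - 2) * r\<bar>" for r :: real
    proof (cases "r = 0")
      case False
      then show ?thesis using powr_add[of "\<bar>r\<bar>" "q - 2" 1] by (simp add: abs_mult)
    qed simp
    ultimately have "((\<lambda>r::real. \<bar>r\<bar> powr (q - 2) * r) \<longlongrightarrow> 0) (at 0)"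
      by (simp add: tendsto_rabs_zero_iff)
    then show ?thesis using True by (simp add: isCont_def)
  qed
  then show ?thesis by (simp add: continuous_at_imp_continuous_on)
qed

text \<open>For q = p + 1 the derivative is p + 1 times the nonlinearity of the wave equation. At 0
  the difference quotient \<open>\<bar>h\<bar> powr q / h\<close> is again
  \<open>\<bar>h\<bar> powr (q - 2) * h\<close>, which tends to 0.\<close>

lemma has_real_derivative_abs_powr:
  fixes q r :: real
  assumes "q > 1"
  shows "((\<lambda>r. \<bar>r\<bar> powr q) has_real_derivative q * (\<bar>r\<bar> powr (q - 2) * r)) (at r)"
proof -
  consider "r > 0" | "r < 0" | "r = 0" by linarith
  then show ?thesis
  proof cases
    case 1
    have "((\<lambda>r. r powr q) has_real_derivative q * r powr (q - 1)) (at r)"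
      using 1 by (rule has_real_derivative_powr)
    then have "((\<lambda>r. \<bar>r\<bar> powr q) has_real_derivative q * r powr (q - 1)) (at r)"
      by (rule has_field_derivative_transform_within_open[of _ _ _ "{0<..}"]) (use 1 in auto)
    moreover have "r powr (q - 1) = r powr (q - 2) * r" using powr_add[of r "q - 2" 1] 1 by simp
    ultimately show ?thesis using 1 by simp
  next
    case 2
    have "((\<lambda>r. (- r) powr q) has_real_derivative - (q * (- r) powr (q - 1))) (at r)"
      using 2 by (auto intro!: derivative_eq_intros)
    then have "((\<lambda>r. \<bar>r\<bar> powr q) has_real_derivative - (q * (- r) powr (q - 1))) (at r)"
      by (rule has_field_derivative_transform_within_open[of _ _ _ "{..<0}"]) (use 2 in auto)
    moreover have "(- r) powr (q - 1) = (- r) powr (q - 2) * (- r)"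
      using powr_add[of "- r" "q - 2" 1] 2 by simp
    ultimately show ?thesis using 2 by simp
  next
    case 3
    have "isCont (\<lambda>r::real. \<bar>r\<bar> powr (q - 2) * r) 0"
      using continuous_on_abs_powr_mult[OF assms] by (simp add: continuous_on_eq_continuous_at)
    then have "((\<lambda>h::real. \<bar>h\<bar> powr (q - 2) * h) \<longlongrightarrow> 0) (at 0)" by (simp add: isCont_def)
    moreover have "\<bar>h\<bar> powr (q - 2) * h = \<bar>h\<bar> powr q / h" for h :: real
    proof (cases "h = 0")
      case False
      have "\<bar>h\<bar> powr q = \<bar>h\<bar> powr (q - 2) * \<bar>h\<bar> powr 2"
        using powr_add[of "\<bar>h\<bar>" "q - 2" 2] by simp
      also have "\<bar>h\<bar> powr 2 = h * h" using False by (simp add: powr_numeral power2_eq_square)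
      finally show ?thesis using False by simp
    qed simp
    ultimately show ?thesis using 3 by (simp add: DERIV_def)
  qed
qed

lemma C1_deriv_powr:
  fixes f :: "'a::real_normed_vector \<Rightarrow> real"
  assumes "C1_deriv \<Omega> f f'" "\<And>z. z \<in> \<Omega> \<Longrightarrow> f z > 0"
  shows "C1_deriv \<Omega> (\<lambda>z. f z powr a) (\<lambda>z h. a * f z powr (a - 1) * f' z h)"
proof (rule C1_deriv_real_comp[OF assms(1)])
  have "0 \<notin> f ` \<Omega>" using assms(2) by force
  then show "continuous_on (f ` \<Omega>) (\<lambda>x. a * x powr (a - 1))"
    by (auto intro!: continuous_intros)
qed (rule has_real_derivative_powr[OF assms(2)])

lemma C1_deriv_abs_powr:
  fixes f :: "'a::real_normed_vector \<Rightarrow> real"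
  assumes "C1_deriv \<Omega> f f'" "q > 1"
  shows "C1_deriv \<Omega> (\<lambda>z. \<bar>f z\<bar> powr q) (\<lambda>z h. q * (\<bar>f z\<bar> powr (q - 2) * f z) * f' z h)"
  by (rule C1_deriv_real_comp[OF assms(1)])
    (use assms(2) in \<open>auto intro!: has_real_derivative_abs_powr continuous_on_mult
      continuous_on_subset[OF continuous_on_abs_powr_mult]\<close>)

section \<open>The weighted energy identity\<close>

text \<open>The three groups on the left are the product-rule divergences of the three summands of
  the multiplier field; \<open>A\<close> is the scaling derivative of \<phi>, \<open>m\<close> a
  Hessian term, \<open>q\<close> the Lorentzian square of the gradient, \<open>N\<close> the
  space-time dimension. The terms with \<open>m\<close> and with \<open>V * g * A\<close> cancel.
  The value of \<open>b\<close> kills \<open>q\<close> where \<open>X\<close> is undifferentiated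
  and gives 2 (a - 1) + N = 2 b, so that the terms with \<open>X * F1\<close> form a square; those
  with \<open>k * F1\<close> cancel against the third group.\<close>

lemma multiplier_algebra:
  fixes A \<phi> q m F F1 f X k c N b a V N0 g GY kY dY SV p U :: real
  assumes p: "p + 1 \<noteq> 0" and F: "F = f * F1" and g: "\<phi> * g = N0" and b: "b = a + (N - 2) / 2"
    and U: "U = V * N0 / (p + 1)"
  shows
    "(X * (F * (m + q + b * q) + 2 * a * F1 * A * (A + b * \<phi>)) + c * (F * (A + b * \<phi>))
       + X * (F * (A + b * \<phi>)) * (- (V * g)))
     + ((X * (F * (SV * N0 / (p + 1) + V * g * A - m) + 2 * a * F * (U - q / 2)
            + (a * b * F1 * (2 * \<phi> * A) + a * b * (2 * (a - 1) * F1) * \<phi>\<^sup>2))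
          + k * (F * (U - q / 2) + a * b * F1 * \<phi>\<^sup>2))
        + X * (F * (U - q / 2) + a * b * F1 * \<phi>\<^sup>2) * N)
     + (- (b / 2) * (F * (\<phi>\<^sup>2 * kY + 2 * \<phi> * GY * k) + 2 * a * F1 * (\<phi>\<^sup>2 * k))
        + - (b / 2) * (F * (\<phi>\<^sup>2 * k)) * dY)
     = X * (2 * a * F1 * (A + b * \<phi>)\<^sup>2
          + F * ((N - b * (p + 1) + 2 * a) * V + SV) * N0 / (p + 1))
       + F * (c * (A + b * \<phi>) + k * (U - q / 2)
          - b / 2 * (2 * \<phi> * GY * k + \<phi>\<^sup>2 * kY + \<phi>\<^sup>2 * k * dY))"
proof -
  have U': "(p + 1) * U = V * N0" using p U by simp
  define W where "W = SV * N0 / (p + 1)"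
  have N: "N = 2 * b - 2 * a + 2" using b by (simp add: field_simps)
  have *: "F * ((N - b * (p + 1) + 2 * a) * V + SV) * N0 / (p + 1)
      = F * ((N + 2 * a) * U - b * (V * N0) + W)"
  proof -
    \<comment> \<open>Naming the inverse makes the claim polynomial, with the one relation
      \<open>(p + 1) * r = 1\<close>.\<close>
    define r where "r = inverse (p + 1)"
    have "(p + 1) * r = 1" using p by (simp add: r_def)
    then show ?thesis unfolding U W_def divide_inverse r_def[symmetric] by algebra
  qed
  show ?thesis unfolding * W_def[symmetric] unfolding N F g[symmetric]
    by (simp add: algebra_simps power2_eq_square)
qed


text \<open>Here \<open>J\<close> is the reflection turning the Euclidean inner product into the Minkowski metric, so that
  \<open>J (G z)\<close> is the space-time gradient of \<open>\<phi>\<close> and \<open>f\<close> the Minkowski square of \<open>z - z0\<close>. The coefficient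
  \<open>b\<close> removes the indefinite term \<open>G z \<bullet> J (G z)\<close>; the \<open>\<phi>\<^sup>2\<close>-terms of order \<open>f powr (a - 1)\<close> complete a
  square where \<open>X\<close> is constant, and the field \<open>Y\<close>, normalised to move \<open>f\<close> at speed 2, cancels the one
  produced by the cutoff \<open>X\<close>.\<close>

lemma C1_div_multiplier:
  fixes \<phi> V X k f :: "'a::euclidean_space \<Rightarrow> real" and G Y J :: "'a \<Rightarrow> 'a" and a b p :: real
  assumes \<Omega>: "open \<Omega>"
    and J: "bounded_linear J" "\<And>u v. J u \<bullet> v = u \<bullet> J v" "\<And>u. J (J u) = u"
    and \<phi>: "C1_deriv \<Omega> \<phi> (\<lambda>z h. G z \<bullet> h)" and G: "C1_deriv \<Omega> G H"
    and V: "C1_deriv \<Omega> V V'" and X: "C1_deriv \<Omega> X X'" and k: "C1_deriv \<Omega> k k'"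
    and k_eq: "\<And>z. z \<in> \<Omega> \<Longrightarrow> k z = X' z (z - z0)"
    and f: "\<And>z. f z = (z - z0) \<bullet> J (z - z0)" and f_pos: "\<And>z. z \<in> \<Omega> \<Longrightarrow> f z > 0"
    and Y: "C1_div \<Omega> Y dY" "\<And>z. z \<in> \<Omega> \<Longrightarrow> J (z - z0) \<bullet> Y z = 1"
    and p: "1 \<le> p" and b: "b = a + (real DIM('a) - 2) / 2"
    and wave: "\<And>z. z \<in> \<Omega> \<Longrightarrow> (\<Sum>e\<in>Basis. J (H z e) \<bullet> e) + V z * (\<bar>\<phi> z\<bar> powr (p - 1) * \<phi> z) = 0"
  defines "A \<equiv> \<lambda>z. (z - z0) \<bullet> G z" and "q \<equiv> \<lambda>z. G z \<bullet> J (G z)"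
    and "U \<equiv> \<lambda>z. V z * \<bar>\<phi> z\<bar> powr (p + 1) / (p + 1)"
  shows "C1_div \<Omega>
     (\<lambda>z. (X z * (f z powr a * (A z + b * \<phi> z))) *\<^sub>R J (G z)
        + (X z * (f z powr a * (U z - q z / 2) + a * b * f z powr (a - 1) * (\<phi> z)\<^sup>2)) *\<^sub>R (z - z0)
        + (- (b / 2) * (f z powr a * ((\<phi> z)\<^sup>2 * k z))) *\<^sub>R Y z)
     (\<lambda>z. X z * (2 * a * f z powr (a - 1) * (A z + b * \<phi> z)\<^sup>2
          + f z powr a * ((real DIM('a) - b * (p + 1) + 2 * a) * V z + V' z (z - z0))
              * \<bar>\<phi> z\<bar> powr (p + 1) / (p + 1))
        + f z powr a * (X' z (J (G z)) * (A z + b * \<phi> z) + k z * (U z - q z / 2)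
            - b / 2 * (2 * \<phi> z * (G z \<bullet> Y z) * k z + (\<phi> z)\<^sup>2 * k' z (Y z) + (\<phi> z)\<^sup>2 * k z * dY z)))"
proof -
  note lin = bounded_linear.linear[OF J(1)]
  note S = C1_deriv_shift[of \<Omega> z0]
  have JG: "C1_deriv \<Omega> (\<lambda>z. J (G z)) (\<lambda>z h. J (H z h))"
    by (rule C1_deriv_linear_comp[OF J(1) G])
  have A': "C1_deriv \<Omega> A (\<lambda>z h. (z - z0) \<bullet> H z h + h \<bullet> G z)"
    unfolding A_def by (rule C1_deriv_inner[OF S G])
  have q': "C1_deriv \<Omega> q (\<lambda>z h. 2 * (H z h \<bullet> J (G z)))"
    unfolding q_def by (rule C1_deriv_cong[OF C1_deriv_inner[OF G JG]]) (metis J(2) inner_commute mult_2)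
  have f': "C1_deriv \<Omega> f (\<lambda>z h. 2 * (J (z - z0) \<bullet> h))"
    unfolding f[abs_def]
    by (rule C1_deriv_cong[OF C1_deriv_inner[OF S C1_deriv_linear_comp[OF J(1) S]]])
      (metis J(2) inner_commute mult_2)
  have N': "C1_deriv \<Omega> (\<lambda>z. \<bar>\<phi> z\<bar> powr (p + 1))
      (\<lambda>z h. (p + 1) * (\<bar>\<phi> z\<bar> powr (p - 1) * \<phi> z) * (G z \<bullet> h))"
    using C1_deriv_abs_powr[OF \<phi>, of "p + 1"] p by simp
  have U': "C1_deriv \<Omega> U (\<lambda>z h. V' z h * \<bar>\<phi> z\<bar> powr (p + 1) / (p + 1)
       + V z * (\<bar>\<phi> z\<bar> powr (p - 1) * \<phi> z) * (G z \<bullet> h))"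
    unfolding U_def divide_inverse
    by (rule C1_deriv_cong[OF C1_deriv_mult[OF C1_deriv_mult[OF V N'] C1_deriv_const[of _ "inverse (p + 1)"]]])
      (use p in \<open>simp add: field_simps\<close>)
  have \<phi>2: "C1_deriv \<Omega> (\<lambda>z. (\<phi> z)\<^sup>2) (\<lambda>z h. 2 * \<phi> z * (G z \<bullet> h))"
    unfolding power2_eq_square by (rule C1_deriv_cong[OF C1_deriv_mult[OF \<phi> \<phi>]]) simp
  note F = C1_deriv_powr[OF f' f_pos]
  have c\<phi>: "C1_deriv \<Omega> (\<lambda>z. c * \<phi> z) (\<lambda>z h. c * (G z \<bullet> h))" for c
    by (rule C1_deriv_cong[OF C1_deriv_mult[OF C1_deriv_const \<phi>]]) simp
  have scal: "C1_deriv \<Omega> (\<lambda>z. c * g z) (\<lambda>z h. c * g' z h)" if "C1_deriv \<Omega> g g'" for c and g :: "'a \<Rightarrow> real" and g'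
    by (rule C1_deriv_cong[OF C1_deriv_mult[OF C1_deriv_const that]]) simp
  have Uq: "C1_deriv \<Omega> (\<lambda>z. U z - q z / 2) (\<lambda>z h. (V' z h * \<bar>\<phi> z\<bar> powr (p + 1) / (p + 1)
       + V z * (\<bar>\<phi> z\<bar> powr (p - 1) * \<phi> z) * (G z \<bullet> h)) - H z h \<bullet> J (G z))"
    using C1_deriv_diff[OF U' scal[OF q', of "1/2"]] by simp
  have divJG: "C1_div \<Omega> (\<lambda>z. J (G z)) (\<lambda>z. - (V z * (\<bar>\<phi> z\<bar> powr (p - 1) * \<phi> z)))"
    unfolding C1_div_def using JG wave by (intro exI[of _ "\<lambda>z h. J (H z h)"]) (simp add: add_eq_0_iff2)
  have divS: "C1_div \<Omega> (\<lambda>z. z - z0) (\<lambda>z. real DIM('a))"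
    unfolding C1_div_def using S by (intro exI[of _ "\<lambda>z h. h"]) (simp add: inner_same_Basis)
  \<comment> \<open>The product rules alone fix the shape of this divergence, which the long
    equation at the end reproduces verbatim.\<close>
  note D = C1_div_add[OF C1_div_add[OF
     C1_div_scaleR[OF C1_deriv_mult[OF X C1_deriv_mult[OF F[of a] C1_deriv_add[OF A' c\<phi>[of b]]]] divJG]
     C1_div_scaleR[OF C1_deriv_mult[OF X C1_deriv_add[OF C1_deriv_mult[OF F[of a] Uq]
        C1_deriv_mult[OF scal[OF F[of "a - 1"], of "a * b"] \<phi>2]]] divS]]
     C1_div_scaleR[OF scal[OF C1_deriv_mult[OF F[of a] C1_deriv_mult[OF \<phi>2 k]], of "- (b / 2)"] Y(1)]]
  show ?thesis
  proof (rule C1_div_cong[OF D])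
    fix z assume z: "z \<in> \<Omega>"
    \<comment> \<open>Symmetry of the Hessian lets the second-order term of the flux along
      \<open>J (G z)\<close> cancel the one obtained by differentiating \<open>q\<close> along
      \<open>z - z0\<close>.\<close>
    have sym: "(z - z0) \<bullet> H z (J (G z)) = H z (z - z0) \<bullet> J (G z)"
      using second_derivative_symmetric[OF \<Omega> \<phi> G z, of "J (G z)" "z - z0"] by (simp add: inner_commute)
    have e: "J (G z) \<bullet> G z = q z" "G z \<bullet> J (G z) = q z" "J (z - z0) \<bullet> J (G z) = A z"
      "J (z - z0) \<bullet> (z - z0) = f z" "G z \<bullet> (z - z0) = A z" "(z - z0) \<bullet> G z = A z"
      using J by (auto simp: q_def A_def f inner_commute)
    have F0: "f z powr a = f z * f z powr (a - 1)" and F1: "f z powr (a - 1) = f z * f z powr (a - 2)"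
      using f_pos[OF z] powr_add[of "f z" 1 "a - 1"] powr_add[of "f z" 1 "a - 2"] by auto
    have g: "\<phi> z * (\<bar>\<phi> z\<bar> powr (p - 1) * \<phi> z) = \<bar>\<phi> z\<bar> powr (p + 1)"
    proof (cases "\<phi> z = 0")
      case False
      have "\<bar>\<phi> z\<bar> powr (p + 1) = \<bar>\<phi> z\<bar> powr (p - 1) * \<bar>\<phi> z\<bar> powr 2"
        using powr_add[of "\<bar>\<phi> z\<bar>" "p - 1" 2] by (simp add: add.commute)
      with False show ?thesis by (simp add: power2_eq_square)
    qed simp
    note alg = multiplier_algebra[of p "f z powr a" "f z" "f z powr (a - 1)" "\<phi> z" "\<bar>\<phi> z\<bar> powr (p - 1) * \<phi> z"
       "\<bar>\<phi> z\<bar> powr (p + 1)" b a "real DIM('a)" "U z" "V z" "X z" "H z (z - z0) \<bullet> J (G z)" "q z" "A z" "X' z (J (G z))"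
       "V' z (z - z0)" "k z" "k' z (Y z)" "G z \<bullet> Y z" "dY z", OF _ F0 g b]
    have p1: "p + 1 \<noteq> 0" using p by simp
    have w: "a * f z powr (a - 1) * (2 * f z) = 2 * a * f z powr a"
      "(a - 1) * f z powr (a - 1 - 1) * (2 * f z) = 2 * (a - 1) * f z powr (a - 1)"
      "a * f z powr (a - 1) * (2 * A z) = 2 * a * f z powr (a - 1) * A z"
      "a * f z powr (a - 1) * (2 * 1) = 2 * a * f z powr (a - 1)"
      using F1 by (simp_all add: F0)
    show "X z * (f z powr a * ((z - z0) \<bullet> H z (J (G z)) + J (G z) \<bullet> G z + b * (G z \<bullet> J (G z)))
          + a * f z powr (a - 1) * (2 * (J (z - z0) \<bullet> J (G z))) * (A z + b * \<phi> z))
        + X' z (J (G z)) * (f z powr a * (A z + b * \<phi> z))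
        + X z * (f z powr a * (A z + b * \<phi> z)) * - (V z * (\<bar>\<phi> z\<bar> powr (p - 1) * \<phi> z))
      + ((X z * (f z powr a * (V' z (z - z0) * \<bar>\<phi> z\<bar> powr (p + 1) / (p + 1)
              + V z * (\<bar>\<phi> z\<bar> powr (p - 1) * \<phi> z) * (G z \<bullet> (z - z0)) - H z (z - z0) \<bullet> J (G z))
            + a * f z powr (a - 1) * (2 * (J (z - z0) \<bullet> (z - z0))) * (U z - q z / 2)
            + (a * b * f z powr (a - 1) * (2 * \<phi> z * (G z \<bullet> (z - z0)))
              + a * b * ((a - 1) * f z powr (a - 1 - 1) * (2 * (J (z - z0) \<bullet> (z - z0)))) * (\<phi> z)\<^sup>2))
          + X' z (z - z0) * (f z powr a * (U z - q z / 2) + a * b * f z powr (a - 1) * (\<phi> z)\<^sup>2))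
        + X z * (f z powr a * (U z - q z / 2) + a * b * f z powr (a - 1) * (\<phi> z)\<^sup>2) * real DIM('a))
      + (- (b / 2) * (f z powr a * ((\<phi> z)\<^sup>2 * k' z (Y z) + 2 * \<phi> z * (G z \<bullet> Y z) * k z)
           + a * f z powr (a - 1) * (2 * (J (z - z0) \<bullet> Y z)) * ((\<phi> z)\<^sup>2 * k z))
        + - (b / 2) * (f z powr a * ((\<phi> z)\<^sup>2 * k z)) * dY z)
      = X z * (2 * a * f z powr (a - 1) * (A z + b * \<phi> z)\<^sup>2
          + f z powr a * ((real DIM('a) - b * (p + 1) + 2 * a) * V z + V' z (z - z0))
              * \<bar>\<phi> z\<bar> powr (p + 1) / (p + 1))
        + f z powr a * (X' z (J (G z)) * (A z + b * \<phi> z) + k z * (U z - q z / 2)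
            - b / 2 * (2 * \<phi> z * (G z \<bullet> Y z) * k z + (\<phi> z)\<^sup>2 * k' z (Y z) + (\<phi> z)\<^sup>2 * k z * dY z))"
      unfolding alg[OF p1 fun_cong[OF meta_eq_to_obj_eq[OF U_def]], symmetric]
        e sym w k_eq[OF z, symmetric] Y(2)[OF z] ..
  qed
qed

section \<open>Cutoff functions\<close>

text \<open>Second-order regularity suffices, since \<open>k\<close> contains the first derivative
  of the cutoff and must itself be continuously differentiable. The inner cube smooths the corner at
  0, the outer one that at 1, and all derivatives are piecewise polynomial.\<close>

definition cutoff :: "real \<Rightarrow> real" where
  "cutoff r = (max 0 (1 - (max 0 r) ^ 3)) ^ 3"

definition cutoff' :: "real \<Rightarrow> real" where
  "cutoff' r = - 9 * (max 0 (1 - (max 0 r) ^ 3))\<^sup>2 * (max 0 r)\<^sup>2"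

definition cutoff'' :: "real \<Rightarrow> real" where
  "cutoff'' r = 54 * max 0 (1 - (max 0 r) ^ 3) * (max 0 r) ^ 4
     - 18 * (max 0 (1 - (max 0 r) ^ 3))\<^sup>2 * max 0 r"

lemma DERIV_max_0_power:
  fixes r :: real
  assumes "n \<ge> 2"
  shows "((\<lambda>r. max 0 r ^ n) has_real_derivative real n * max 0 r ^ (n - 1)) (at r)"
proof -
  consider "r > 0" | "r < 0" | "r = 0" by linarith
  then show ?thesis
  proof cases
    case 1
    have "((\<lambda>r. r ^ n) has_real_derivative real n * r ^ (n - 1)) (at r)"
      by (auto intro!: derivative_eq_intros)
    then have "((\<lambda>r. max 0 r ^ n) has_real_derivative real n * r ^ (n - 1)) (at r)"
      by (rule has_field_derivative_transform_within_open[of _ _ _ "{0<..}"]) (use 1 in auto)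
    with 1 show ?thesis by simp
  next
    case 2
    have "((\<lambda>r::real. 0) has_real_derivative 0) (at r)" by simp
    then have "((\<lambda>r. max 0 r ^ n) has_real_derivative 0) (at r)"
      by (rule has_field_derivative_transform_within_open[of _ _ _ "{..<0}"]) (use 2 assms in auto)
    with 2 assms show ?thesis by (simp add: max_absorb1 power_0_left)
  next
    case 3
    have z: "max 0 (0::real) ^ (n - 1) = 0" using assms by (simp add: power_0_left)
    have "((\<lambda>h::real. max 0 h ^ (n - 1)) \<longlongrightarrow> max 0 0 ^ (n - 1)) (at 0)"
      by (intro tendsto_intros)
    then have "((\<lambda>h::real. max 0 h ^ (n - 1)) \<longlongrightarrow> 0) (at 0)" unfolding z .
    moreover have "\<bar>max 0 h ^ n / h\<bar> \<le> max 0 h ^ (n - 1)" for h :: real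
    proof (cases "h \<le> 0")
      case True
      then show ?thesis using assms by (simp add: max_absorb1 power_0_left)
    next
      case False
      then show ?thesis using assms by (cases n) auto
    qed
    ultimately have "((\<lambda>h::real. max 0 h ^ n / h) \<longlongrightarrow> 0) (at 0)"
      by (intro Lim_null_comparison[where f = "\<lambda>h. max 0 h ^ n / h" and g = "\<lambda>h. max 0 h ^ (n - 1)"]) auto
    then show ?thesis using 3 assms by (simp add: DERIV_def power_0_left)
  qed
qed

lemma DERIV_cutoff: "(cutoff has_real_derivative cutoff' r) (at r)"
proof -
  have 1: "((\<lambda>r. 1 - max 0 r ^ 3) has_real_derivative - (3 * (max 0 r)\<^sup>2)) (at r)"
    using DERIV_diff[OF DERIV_const[of 1] DERIV_max_0_power[of 3 r]] by simp
  show ?thesis unfolding cutoff_def[abs_def]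
    using DERIV_chain2[OF DERIV_max_0_power[of 3] 1] by (simp add: cutoff'_def algebra_simps)
qed

lemma DERIV_cutoff': "(cutoff' has_real_derivative cutoff'' r) (at r)"
proof -
  have 1: "((\<lambda>r. 1 - max 0 r ^ 3) has_real_derivative - (3 * (max 0 r)\<^sup>2)) (at r)"
    using DERIV_diff[OF DERIV_const[of 1] DERIV_max_0_power[of 3 r]] by simp
  have 2: "((\<lambda>r. (max 0 r)\<^sup>2) has_real_derivative 2 * max 0 r) (at r)"
    using DERIV_max_0_power[of 2 r] by simp
  have 3: "((\<lambda>r. (max 0 (1 - max 0 r ^ 3))\<^sup>2) has_real_derivative
      2 * max 0 (1 - max 0 r ^ 3) * - (3 * (max 0 r)\<^sup>2)) (at r)"
    using DERIV_chain2[OF DERIV_max_0_power[of 2] 1] by simp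
  show ?thesis unfolding cutoff'_def[abs_def]
    using DERIV_cmult[OF DERIV_mult[OF 3 2], of "-9"]
    by (simp add: cutoff''_def algebra_simps power2_eq_square power4_eq_xxxx)
qed

lemma continuous_on_cutoff: "continuous_on S cutoff" "continuous_on S cutoff'" "continuous_on S cutoff''"
  unfolding cutoff_def[abs_def] cutoff'_def[abs_def] cutoff''_def[abs_def]
  by (intro continuous_intros)+

lemma cutoff_nonpos: "r \<le> 0 \<Longrightarrow> cutoff r = 1" "r \<le> 0 \<Longrightarrow> cutoff' r = 0" "r \<le> 0 \<Longrightarrow> cutoff'' r = 0"
  by (simp_all add: cutoff_def cutoff'_def cutoff''_def)

lemma cutoff_ge_1: "r \<ge> 1 \<Longrightarrow> cutoff r = 0" "r \<ge> 1 \<Longrightarrow> cutoff' r = 0" "r \<ge> 1 \<Longrightarrow> cutoff'' r = 0"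
  using one_le_power[of r 3] by (simp_all add: cutoff_def cutoff'_def cutoff''_def)

lemma cutoff_bounds: "0 \<le> cutoff r" "cutoff r \<le> 1" "cutoff' r \<le> 0"
  by (auto simp: cutoff_def cutoff'_def intro!: power_le_one)

lemma cutoff_antimono: "r \<le> s \<Longrightarrow> cutoff s \<le> cutoff r"
  by (rule DERIV_nonpos_imp_nonincreasing) (auto intro!: exI DERIV_cutoff cutoff_bounds)

lemma cutoff_half_pos: "0 < cutoff (1/2)"
  by (simp add: cutoff_def power_divide)

lemma cutoff_derivs_bounded: "\<exists>M>0. \<forall>r. \<bar>cutoff' r\<bar> \<le> M \<and> \<bar>cutoff'' r\<bar> \<le> M"
proof -
  have "bounded (cutoff' ` {0..1})" "bounded (cutoff'' ` {0..1})"
    by (auto intro!: compact_imp_bounded compact_continuous_image continuous_on_cutoff)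
  then obtain M1 M2 where M: "\<forall>r\<in>{0..1}. \<bar>cutoff' r\<bar> \<le> M1" "\<forall>r\<in>{0..1}. \<bar>cutoff'' r\<bar> \<le> M2"
    unfolding bounded_iff by auto
  have "\<bar>cutoff' r\<bar> \<le> max 1 (max M1 M2) \<and> \<bar>cutoff'' r\<bar> \<le> max 1 (max M1 M2)" for r
  proof (cases "r \<in> {0..1}")
    case True
    then show ?thesis using M by (meson max.coboundedI1 max.coboundedI2)
  next
    case False
    then have "r \<le> 0 \<or> r \<ge> 1" by auto
    then show ?thesis using cutoff_nonpos(2,3) cutoff_ge_1(2,3) by auto
  qed
  then show ?thesis by (intro exI[of _ "max 1 (max M1 M2)"]) auto
qed

section \<open>Weights degenerating on a level set\<close>

text \<open>The field \<open>Z\<close> only serves to bound the integral of the derivative of the approximate indicator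
  of \<open>f > 0\<close> independently of the approximation, so that the flux of \<open>W\<close> through \<open>f = 0\<close> vanishes.\<close>

lemma integral_le_of_divergence_degenerate:
  fixes W Z :: "'a::euclidean_space \<Rightarrow> 'a" and f d dZ P Q :: "'a \<Rightarrow> real"
  assumes \<Omega>: "open \<Omega>" and f: "C1_deriv \<Omega> f f'" and f_cont: "continuous_on UNIV f"
    and f_pos: "\<And>z. z \<in> \<Omega> \<Longrightarrow> f z > 0"
    and K: "compact K" "\<And>z. z \<in> K \<Longrightarrow> f z > 0 \<Longrightarrow> z \<in> \<Omega>"
    and W: "C1_div \<Omega> W d" "\<And>z. f z > 0 \<Longrightarrow> z \<notin> K \<Longrightarrow> W z = 0"
    and Z: "C1_div \<Omega> Z dZ" "\<And>z. f z > 0 \<Longrightarrow> z \<notin> K \<Longrightarrow> Z z = 0"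
    and flux: "\<And>z. z \<in> \<Omega> \<inter> K \<Longrightarrow> \<bar>f' z (W z)\<bar> \<le> M * f z powr a * f' z (Z z)"
    and nonneg: "\<And>z. z \<in> \<Omega> \<inter> K \<Longrightarrow> 0 \<le> f' z (Z z)"
    and dZ: "\<And>z. z \<in> \<Omega> \<inter> K \<Longrightarrow> \<bar>dZ z\<bar> \<le> D"
    and a: "a > 0" and M: "M \<ge> 0" and c: "c > 0"
    and P: "integrable lborel P" "\<And>z. P z \<noteq> 0 \<Longrightarrow> z \<in> \<Omega> \<inter> K \<and> c \<le> f z" "\<And>z. 0 \<le> P z"
    and Q: "integrable lborel Q" "\<And>z. 0 \<le> Q z"
    and PQ: "\<And>z. z \<in> \<Omega> \<inter> K \<Longrightarrow> P z \<le> d z + Q z"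
  shows "integral\<^sup>L lborel P \<le> integral\<^sup>L lborel Q"
proof -
  define D' where "D' = \<bar>D\<bar>"
  have main: "integral\<^sup>L lborel P \<le> integral\<^sup>L lborel Q + M * (2 * e) powr a * (D' * measure lborel K)"
    if e: "0 < e" "2 * e \<le> c" for e
  proof -
    \<comment> \<open>An approximate indicator of f > 0: it is 0 for f < e and 1 for f \<ge> 2 e.
      The assumption \<open>2 * e \<le> c\<close> makes it 1 on the support of
      \<open>P\<close>.\<close>
    define \<psi> where "\<psi> z = 1 - cutoff (f z / e - 1)" for z
    define \<psi>' where "\<psi>' z = - cutoff' (f z / e - 1) / e" for z
    define L where "L = K \<inter> f -` {e..}"
    have L: "compact L" unfolding L_def
      using K f_cont by (intro compact_Int_closed closed_vimage) auto
    have L\<Omega>: "L \<subseteq> \<Omega>" using K e by (auto simp: L_def)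
    have \<psi>0: "\<psi> z = 0" if "f z < e" for z
      using that e by (simp add: \<psi>_def cutoff_nonpos field_simps)
    have \<psi>1: "\<psi> z = 1" if "f z \<ge> 2 * e" for z
      using that e by (simp add: \<psi>_def cutoff_ge_1 field_simps)
    have \<psi>b: "0 \<le> \<psi> z" "\<psi> z \<le> 1" "0 \<le> \<psi>' z" for z
      using cutoff_bounds e by (auto simp: \<psi>_def \<psi>'_def divide_nonpos_pos)
    have \<psi>'0: "\<psi>' z = 0" if "f z \<ge> 2 * e" for z
      using that e by (simp add: \<psi>'_def cutoff_ge_1 field_simps)
    have C1\<psi>: "C1_deriv \<Omega> \<psi> (\<lambda>z h. \<psi>' z * f' z h)"
      unfolding \<psi>_def \<psi>'_def
    proof (rule C1_deriv_real_comp[OF f])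
      show "((\<lambda>x. 1 - cutoff (x / e - 1)) has_real_derivative - cutoff' (f z / e - 1) / e) (at (f z))" for z
        using e by (auto intro!: derivative_eq_intros DERIV_chain2[OF DERIV_cutoff])
      show "continuous_on (f ` \<Omega>) (\<lambda>x. - cutoff' (x / e - 1) / e)"
        using e by (auto intro!: continuous_intros continuous_on_compose2[OF continuous_on_cutoff(2)[of UNIV]])
    qed
    have W0: "\<psi> z *\<^sub>R W z = 0" "\<psi> z *\<^sub>R Z z = 0" if "z \<notin> L" for z
    proof -
      have "f z < e \<or> f z > 0" using e by linarith
      then show "\<psi> z *\<^sub>R W z = 0" "\<psi> z *\<^sub>R Z z = 0"
        using that \<psi>0[of z] W(2)[of z] Z(2)[of z] by (auto simp: L_def not_le)
    qed
    note IW = integral_divergence[OF C1_div_scaleR[OF C1\<psi> W(1)] \<Omega> L L\<Omega> W0(1)]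
    note IZ = integral_divergence[OF C1_div_scaleR[OF C1\<psi> Z(1)] \<Omega> L L\<Omega> W0(2)]
    \<comment> \<open>Where \<psi>' is nonzero, f < 2 e, so the flux of \<open>W\<close> is at most
      \<open>E\<close> times that of \<open>Z\<close>. Adding \<open>E\<close> times the divergence
      of \<psi> \<open>Z\<close> absorbs the derivative of \<psi>, whose size 1 / e then never
      enters.\<close>
    define E where "E = M * (2 * e) powr a"
    have E: "E \<ge> 0" using M by (simp add: E_def)
    have "emeasure lborel K < top" using emeasure_compact_finite[OF K(1)] by simp
    then have "has_bochner_integral lborel (\<lambda>z. indicator \<Omega> z * (\<psi>' z * f' z (W z) + \<psi> z * d z)
       + E * (indicator \<Omega> z * (\<psi>' z * f' z (Z z) + \<psi> z * dZ z)) + Q z + E * (D' * indicator K z))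
       (0 + E * 0 + integral\<^sup>L lborel Q + E * (D' * measure lborel K))"
      using IW(1) IZ(1) Q K
      by (intro has_bochner_integral_add has_bochner_integral_mult_right)
        (auto simp: has_bochner_integral_integrable borel_compact
           intro!: has_bochner_integral_real_indicator)
    moreover have "P z \<le> indicator \<Omega> z * (\<psi>' z * f' z (W z) + \<psi> z * d z)
       + E * (indicator \<Omega> z * (\<psi>' z * f' z (Z z) + \<psi> z * dZ z)) + Q z + E * (D' * indicator K z)" for z
    proof (cases "z \<in> \<Omega> \<inter> K")
      case False
      have "indicator \<Omega> z * (\<psi>' z * f' z (W z) + \<psi> z * d z) = 0"
        "indicator \<Omega> z * (\<psi>' z * f' z (Z z) + \<psi> z * dZ z) = 0"
        using IW(2)[of z] IZ(2)[of z] False by (auto simp: L_def indicator_def)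
      moreover have "P z = 0" using P(2)[of z] False by auto
      ultimately show ?thesis using Q(2)[of z] E by (simp only: D'_def) simp
    next
      case True
      have \<psi>P: "\<psi> z * P z = P z" using P(2)[of z] \<psi>1[of z] e by (cases "P z = 0") auto
      have "P z \<le> \<psi> z * (d z + Q z)"
        using mult_left_mono[OF PQ[OF True] \<psi>b(1)[of z]] unfolding \<psi>P .
      also have "\<psi> z * (d z + Q z) \<le> \<psi> z * d z + Q z"
        using mult_right_mono[OF \<psi>b(2)[of z] Q(2)[of z]] by (simp add: algebra_simps)
      finally have 1: "P z \<le> \<psi> z * d z + Q z" .
      have "\<psi>' z * \<bar>f' z (W z)\<bar> \<le> \<psi>' z * (E * f' z (Z z))"
      proof (cases "f z \<ge> 2 * e")
        case False
        have "f z powr a \<le> (2 * e) powr a"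
          using False f_pos[of z] True a by (intro powr_mono2) auto
        then have "M * f z powr a * f' z (Z z) \<le> E * f' z (Z z)"
          unfolding E_def using M nonneg[OF True] by (intro mult_right_mono mult_left_mono) auto
        with flux[OF True] \<psi>b(3)[of z] show ?thesis by (intro mult_left_mono) auto
      qed (simp add: \<psi>'0)
      then have 2: "- (E * (\<psi>' z * f' z (Z z))) \<le> \<psi>' z * f' z (W z)"
        using \<psi>b(3)[of z] abs_ge_minus_self[of "\<psi>' z * f' z (W z)"] by (simp add: abs_mult algebra_simps)
      have "\<bar>\<psi> z * dZ z\<bar> \<le> 1 * D'"
        unfolding abs_mult using \<psi>b[of z] dZ[OF True] by (intro mult_mono) (auto simp: D'_def)
      then have "E * (- D') \<le> E * (\<psi> z * dZ z)" using E by (intro mult_left_mono) auto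
      with 1 2 True show ?thesis by (simp add: algebra_simps)
    qed
    ultimately show ?thesis
      using integral_mono[OF P(1)] unfolding has_bochner_integral_iff by (metis (no_types, lifting) E_def add_0 mult_zero_right)
  qed
  \<comment> \<open>The leftover is of order e powr a and ends as \<open>0 powr a = 0\<close>. The
    constants \<open>M\<close> and \<open>D\<close> may therefore depend on the fields in any way;
    only their finiteness matters.\<close>
  have "((\<lambda>e. integral\<^sup>L lborel Q + M * (2 * e) powr a * (D' * measure lborel K)) \<longlongrightarrow>
      integral\<^sup>L lborel Q + M * (2 * 0) powr a * (D' * measure lborel K)) (at_right 0)"
    using a by (intro tendsto_intros tendsto_powr') (auto simp: eventually_at_right_less intro!: tendsto_eq_intros eventually_at_right_less[THEN eventually_mono])
  moreover have "\<forall>\<^sub>F e in at_right 0. integral\<^sup>L lborel P \<le> integral\<^sup>L lborel Q + M * (2 * e) powr a * (D' * measure lborel K)"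
    unfolding eventually_at_right_field using main c by (intro exI[of _ "c/2"]) auto
  ultimately have "integral\<^sup>L lborel P \<le> integral\<^sup>L lborel Q + M * (2 * 0) powr a * (D' * measure lborel K)"
    by (intro tendsto_lowerbound) auto
  then show ?thesis by simp
qed

section \<open>The cutoff and the hyperbolic weight with vertex on the outer cone\<close>

lemma C1_deriv_bilinear_quadratic:
  assumes "bounded_bilinear B"
  shows "C1_deriv \<Omega> (\<lambda>z. B z (z - c)) (\<lambda>z h. B z h + B h (z - c))"
  by (rule C1_deriv_cong[OF C1_deriv_bilinear[OF assms C1_deriv_bounded_linear[OF bounded_linear_ident]
      C1_deriv_shift]]) simp

text \<open>The vertex \<open>z0\<close> lies on the outer cone, so \<open>f > 0\<close> covers a neighbourhood of the slice \<open>t = t0\<close> of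
  the inner cone, while \<open>K\<close> stays away from \<open>z0\<close> and is compact in the outer cone.\<close>

lemma sum_Basis_prod:
  fixes g :: "'a::euclidean_space \<times> 'b::euclidean_space \<Rightarrow> 'c::comm_monoid_add"
  shows "sum g Basis = (\<Sum>i\<in>Basis. g (i, 0)) + (\<Sum>i\<in>Basis. g (0, i))"
proof -
  have "inj_on (\<lambda>i. (i::'a, 0::'b)) Basis" "inj_on (\<lambda>i. (0::'a, i::'b)) Basis"
    by (auto intro!: inj_onI)
  then show ?thesis unfolding Basis_prod_def
    by (subst sum.union_disjoint) (auto simp: sum.reindex)
qed

text \<open>The three constants depend on the slopes only. \<kappa> is a quarter of the gap between
  them; \<delta> t0 is the width scale of the cutoff layer, small enough to keep the layer inside
  the outer cone at all times above (1 - \<sigma>1) / 4 * t0; T t0 bounds the points that occur. The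
  direction \<open>e\<close> is arbitrary.\<close>

locale cone_weight =
  fixes \<sigma>0 \<sigma>1 t0 \<delta> \<kappa> T :: real and e :: "'b::euclidean_space"
  assumes \<sigma>: "0 < \<sigma>0" "\<sigma>0 < \<sigma>1" "\<sigma>1 < 1" and t0: "0 < t0" and e: "norm e = 1"
    and \<delta>: "\<delta> = (1 - \<sigma>1) / 4 * ((\<sigma>1 - \<sigma>0) / 2)" and \<kappa>: "\<kappa> = (\<sigma>1 - \<sigma>0) / 4" and T: "T = 6 / (1 - \<sigma>1)"
begin

definition z0 :: "real \<times> 'b" where "z0 = (t0, (\<sigma>1 * t0) *\<^sub>R e)"

definition J :: "real \<times> 'b \<Rightarrow> real \<times> 'b" where "J z = (- fst z, snd z)"

definition f :: "real \<times> 'b \<Rightarrow> real" where "f z = (z - z0) \<bullet> J (z - z0)"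

text \<open>The Hessian of \<open>u\<close>. Describing the cone of slope \<sigma>0 by a quadratic
  function, not by |x| - \<sigma>0 t, keeps the cutoff differentiable at x = 0 and its derivatives
  explicit.\<close>

definition B :: "real \<times> 'b \<Rightarrow> real \<times> 'b \<Rightarrow> real" where
  "B z h = 2 / (\<delta> * t0)\<^sup>2 * (z \<bullet> (- (\<sigma>0\<^sup>2) * fst h, snd h))"

definition u :: "real \<times> 'b \<Rightarrow> real" where "u z = B z z / 2"

text \<open>The bound is 2 and not 1 because \<open>K\<close> has to hold the support of
  \<open>Z\<close> as well, whose cutoff runs up to u = 2. Points with f = 0 are included for
  compactness.\<close>

definition K :: "(real \<times> 'b) set" where "K = {z. 0 \<le> f z \<and> u z \<le> 2}"

definition k :: "real \<times> 'b \<Rightarrow> real" where "k z = cutoff' (u z) * B z (z - z0)"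

definition k' :: "real \<times> 'b \<Rightarrow> real \<times> 'b \<Rightarrow> real" where
  "k' z h = cutoff' (u z) * (B z h + B h (z - z0)) + cutoff'' (u z) * B z h * B z (z - z0)"

text \<open>The spatial displacement from the vertex. Its pairing with \<open>J (z - z0)\<close> is
  its squared length, which on \<open>K\<close> stays away from 0 even where f vanishes, so this
  direction crosses the level sets of f transversally.\<close>

definition y :: "real \<times> 'b \<Rightarrow> real \<times> 'b" where "y z = (0, snd (z - z0))"

definition Y :: "real \<times> 'b \<Rightarrow> real \<times> 'b" where "Y z = inverse (y z \<bullet> y z) *\<^sub>R y z"

definition dY :: "real \<times> 'b \<Rightarrow> real" where "dY z = (real DIM('b) - 2) / (y z \<bullet> y z)"

text \<open>At half the argument the cutoff is at least \<open>cutoff (1/2)\<close> wherever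
  \<open>cutoff (u z)\<close> is nonzero, so the flux of \<open>Z\<close> can dominate that of the
  multiplier field.\<close>

definition Z :: "real \<times> 'b \<Rightarrow> real \<times> 'b" where "Z z = cutoff (u z / 2) *\<^sub>R y z"

section \<open>Geometry of the compact region\<close>

lemma pos: "0 < \<delta>" "0 < \<kappa>" "1 \<le> T"
  unfolding \<delta> \<kappa> T using \<sigma> by (simp, simp, simp add: pos_le_divide_eq)

lemma J: "bounded_linear J" "J v \<bullet> w = v \<bullet> J w" "J (J v) = v" "norm (J v) = norm v"
proof -
  show "bounded_linear J" unfolding J_def[abs_def]
    by (intro bounded_linear_Pair bounded_linear_minus bounded_linear_fst bounded_linear_snd)
qed (auto simp: J_def inner_prod_def norm_prod_def)

lemma f_eq: "f z = (norm (y z))\<^sup>2 - (fst z - t0)\<^sup>2"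
  by (simp add: f_def J_def y_def z0_def inner_prod_def dot_square_norm)
    (simp add: power2_eq_square algebra_simps)

lemma u_eq: "u z = ((norm (snd z))\<^sup>2 - \<sigma>0\<^sup>2 * (fst z)\<^sup>2) / (\<delta> * t0)\<^sup>2"
proof -
  have half: "2 / D * X / 2 = X / D" for D X :: real by simp
  have *: "z \<bullet> (- (\<sigma>0\<^sup>2) * fst z, snd z) = (norm (snd z))\<^sup>2 - \<sigma>0\<^sup>2 * (fst z)\<^sup>2"
    by (simp add: inner_prod_def dot_square_norm) (simp add: power2_eq_square)
  show ?thesis unfolding u_def B_def * by (rule half)
qed

lemma B_bilinear: "bounded_bilinear B"
proof -
  have "bounded_linear (\<lambda>h::real \<times> 'b. (2 / (\<delta> * t0)\<^sup>2) *\<^sub>R (- (\<sigma>0\<^sup>2) * fst h, snd h))"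
    by (intro bounded_linear_scaleR_right[THEN bounded_linear_compose] bounded_linear_Pair
        bounded_linear_const_mult bounded_linear_fst bounded_linear_snd)
  from bounded_bilinear.comp[OF bounded_bilinear_inner bounded_linear_ident this]
  show ?thesis unfolding B_def[abs_def] inner_scaleR_right .
qed

lemma B_sym: "B z h = B h z"
  by (simp add: B_def inner_prod_def inner_commute)

lemma B_bound: "\<bar>B z h\<bar> \<le> 2 / (\<delta> * t0)\<^sup>2 * (norm z * norm h)"
proof -
  have "\<sigma>0\<^sup>2 \<le> 1" using \<sigma> by (simp add: power_le_one)
  then have "norm (- (\<sigma>0\<^sup>2) * fst h, snd h) \<le> norm h"
    unfolding norm_prod_def prod.sel
    by (intro real_sqrt_le_mono add_right_mono power_mono) (auto simp: abs_mult mult_left_le_one_le)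
  then have "\<bar>z \<bullet> (- (\<sigma>0\<^sup>2) * fst h, snd h)\<bar> \<le> norm z * norm h"
    using Cauchy_Schwarz_ineq2[of z "(- (\<sigma>0\<^sup>2) * fst h, snd h)"] by (meson mult_left_mono norm_ge_zero order_trans)
  then show ?thesis unfolding B_def abs_mult by (intro mult_mono) auto
qed

lemma C1_u: "C1_deriv \<Omega> u B"
proof -
  have "C1_deriv \<Omega> (\<lambda>z. B z (z - 0) / 2) (\<lambda>z h. (B z h + B h (z - 0)) / 2)"
    by (rule C1_deriv_linear_comp[OF bounded_linear_divide C1_deriv_bilinear_quadratic[OF B_bilinear]])
  then show ?thesis by (simp add: u_def[abs_def] B_sym[of _ "_::real \<times> 'b", symmetric])
qed

lemma continuous_f: "continuous_on S f" and continuous_u: "continuous_on S u"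
  and continuous_y: "continuous_on S y"
proof -
  show "continuous_on S f" unfolding f_def[abs_def] J_def by (intro continuous_intros)
  show "continuous_on S u" using C1_deriv_cont[OF C1_u] .
  show "continuous_on S y" unfolding y_def[abs_def] by (intro continuous_intros)
qed

text \<open>With x0 the spatial part of the vertex, f \<ge> 0 gives |t - t0| \<le> |x - x0|, and u
  \<le> 2 gives |x| \<le> \<sigma>0 |t| + 2 \<delta> t0. As x0 has length \<sigma>1 t0 and the
  slopes are below 1, the triangle inequality bounds t from both sides by multiples of t0; the
  remaining bounds follow from that.\<close>

lemma K_geometry:
  assumes "z \<in> K"
  shows "(1 - \<sigma>1) / 4 * t0 < fst z" "fst z * (1 - \<sigma>1) \<le> 3 * t0" "norm (snd z) < \<sigma>1 * fst z"
    "\<kappa> * t0 \<le> norm (y z)" "norm z \<le> T * t0" "norm (z - z0) \<le> 2 * T * t0"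
proof -
  define r s w where "r = norm (snd z)" and "s = fst z" and "w = norm (y z)"
  have f0: "(s - t0)\<^sup>2 \<le> w\<^sup>2" using assms by (auto simp: K_def f_eq s_def w_def)
  have w0: "0 \<le> w" "0 \<le> r" by (auto simp: w_def r_def)
  have sw: "\<bar>s - t0\<bar> \<le> w" using f0 w0 by (simp add: abs_le_square_iff[symmetric])
  have rw: "w \<le> r + \<sigma>1 * t0" "\<sigma>1 * t0 \<le> r + w"
    using norm_triangle_ineq4[of "snd z" "(\<sigma>1 * t0) *\<^sub>R e"] norm_triangle_ineq4[of "snd z" "snd z - (\<sigma>1 * t0) *\<^sub>R e"] \<sigma> t0 e
    by (auto simp: w_def r_def y_def z0_def norm_Pair)
  have u2: "r\<^sup>2 - \<sigma>0\<^sup>2 * s\<^sup>2 \<le> 2 * (\<delta> * t0)\<^sup>2"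
    using assms pos t0 by (auto simp: K_def u_eq r_def s_def divide_le_eq)
  have "r\<^sup>2 \<le> (\<sigma>0 * \<bar>s\<bar> + 2 * (\<delta> * t0))\<^sup>2"
  proof -
    have "0 \<le> \<sigma>0 * \<bar>s\<bar> * (\<delta> * t0)" "0 \<le> (\<delta> * t0)\<^sup>2" using \<sigma> pos t0 by auto
    then have "\<sigma>0\<^sup>2 * s\<^sup>2 + 2 * (\<delta> * t0)\<^sup>2 \<le> (\<sigma>0 * \<bar>s\<bar> + 2 * (\<delta> * t0))\<^sup>2"
      by (simp add: power2_eq_square algebra_simps)
    with u2 show ?thesis by linarith
  qed
  then have r: "r \<le> \<sigma>0 * \<bar>s\<bar> + 2 * (\<delta> * t0)"
    by (rule power2_le_imp_le) (use \<sigma> pos t0 in simp)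
  have d1: "2 * (\<delta> * t0) \<le> (1 - \<sigma>1) / 4 * t0"
  proof -
    have "2 * \<delta> \<le> (1 - \<sigma>1) / 4 * 1" unfolding \<delta> using \<sigma> by (simp add: mult_left_le)
    from mult_right_mono[OF this, of t0] t0 show ?thesis by simp
  qed
  have d2: "2 * (\<delta> * t0) \<le> \<kappa> * t0"
  proof -
    have "(1 - \<sigma>1) * \<kappa> \<le> 1 * \<kappa>" using \<sigma> pos by (intro mult_right_mono) auto
    also have "(1 - \<sigma>1) * \<kappa> = 2 * \<delta>" by (simp add: \<delta> \<kappa>)
    finally show ?thesis using mult_right_mono[of "2 * \<delta>" \<kappa> t0] t0 by simp
  qed
  have st: "\<sigma>1 * t0 < t0" using \<sigma> t0 by simp
  \<comment> \<open>\<open>u\<close> is even in time, so the backward inner cone must be excluded: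
    there f is negative, because \<sigma>1 t0 + 2 \<delta> t0 < t0.\<close>
  have s0: "0 \<le> s"
  proof (rule ccontr)
    assume "\<not> 0 \<le> s"
    then have "\<sigma>0 * \<bar>s\<bar> \<le> - s" using \<sigma> by (simp add: mult_left_le_one_le)
    with r rw sw d1 \<open>\<not> 0 \<le> s\<close> have "t0 \<le> \<sigma>1 * t0 + (1 - \<sigma>1) / 4 * t0" by linarith
    moreover have "(1 - \<sigma>1) / 4 * t0 < (1 - \<sigma>1) * t0" using \<sigma> t0 by (simp add: field_simps)
    ultimately show False by (simp add: algebra_simps)
  qed
  have ss: "\<sigma>0 * s \<le> s" using s0 \<sigma> by (simp add: mult_left_le_one_le)
  have "t0 - \<sigma>1 * t0 - (1 - \<sigma>1) / 4 * t0 \<le> 2 * s" using r rw sw d1 s0 ss by simp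
  moreover have m: "(1 - \<sigma>1) / 4 * t0 = (1 - \<sigma>1) * t0 / 4" "t0 - \<sigma>1 * t0 = (1 - \<sigma>1) * t0"
    by (simp_all add: left_diff_distrib)
  ultimately have "(3/4) * ((1 - \<sigma>1) * t0) \<le> 2 * s" by linarith
  moreover have "0 < (1 - \<sigma>1) * t0" using \<sigma> t0 by simp
  ultimately show s1: "(1 - \<sigma>1) / 4 * t0 < fst z" unfolding s_def[symmetric] m by linarith
  have ss1: "\<sigma>0 * s \<le> \<sigma>1 * s" using s0 \<sigma> by (intro mult_right_mono) auto
  have "(1 - \<sigma>1) / 4 * t0 \<le> t0 / 4" using \<sigma> t0 by (simp add: field_simps)
  moreover have r': "r \<le> \<sigma>0 * s + 2 * (\<delta> * t0)" using r s0 by simp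
  ultimately have "s \<le> 3 * t0 + \<sigma>1 * s" using rw sw d1 ss1 st t0 by linarith
  then show s2: "fst z * (1 - \<sigma>1) \<le> 3 * t0" by (simp add: s_def algebra_simps)
  have s_pos: "0 < s" using s1 \<open>0 < (1 - \<sigma>1) * t0\<close> by (simp add: s_def)
  \<comment> \<open>Here the form of \<delta> is used: the lower bound on t gives \<delta> t0 \<le>
    t (\<sigma>1 - \<sigma>0) / 2, so the layer is thinner than the gap between the cones.\<close>
  have "r\<^sup>2 < (\<sigma>1 * s)\<^sup>2"
  proof -
    have "\<delta> * t0 \<le> s * ((\<sigma>1 - \<sigma>0) / 2)"
      using mult_right_mono[of "(1 - \<sigma>1) / 4 * t0" s "(\<sigma>1 - \<sigma>0) / 2"] s1 \<sigma> by (simp add: s_def \<delta> algebra_simps)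
    then have "(\<delta> * t0)\<^sup>2 \<le> (s * ((\<sigma>1 - \<sigma>0) / 2))\<^sup>2" using pos t0 by (intro power_mono) auto
    then have "2 * (\<delta> * t0)\<^sup>2 \<le> s\<^sup>2 * ((\<sigma>1 - \<sigma>0)\<^sup>2 / 2)" by (simp add: power_mult_distrib power_divide)
    also have "\<dots> < s\<^sup>2 * (\<sigma>1\<^sup>2 - \<sigma>0\<^sup>2)"
    proof (rule mult_strict_left_mono)
      have "(\<sigma>1 - \<sigma>0) * (\<sigma>1 - \<sigma>0) \<le> (\<sigma>1 - \<sigma>0) * (\<sigma>1 + \<sigma>0)" using \<sigma> by (intro mult_left_mono) auto
      moreover have "0 < (\<sigma>1 - \<sigma>0) * (\<sigma>1 - \<sigma>0)" using \<sigma> by simp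
      moreover have "(\<sigma>1 - \<sigma>0) * (\<sigma>1 + \<sigma>0) = \<sigma>1\<^sup>2 - \<sigma>0\<^sup>2" by (simp add: algebra_simps power2_eq_square)
      ultimately show "(\<sigma>1 - \<sigma>0)\<^sup>2 / 2 < \<sigma>1\<^sup>2 - \<sigma>0\<^sup>2" unfolding power2_eq_square[of "\<sigma>1 - \<sigma>0"] by linarith
    qed (use s_pos in simp)
    finally show ?thesis using u2 by (simp add: power_mult_distrib algebra_simps)
  qed
  then have r1: "r < \<sigma>1 * s" by (rule power2_less_imp_less) (use \<sigma> s_pos in simp)
  then show "norm (snd z) < \<sigma>1 * fst z" by (simp add: r_def s_def)
  \<comment> \<open>Close to the spatial vertex t would be close to t0, and |x| would be both near
    \<sigma>1 t0 and at most about \<sigma>0 t0.\<close>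
  have "\<sigma>1 * t0 \<le> \<sigma>0 * s + \<kappa> * t0 + w" using rw r' d2 by linarith
  moreover have "\<sigma>0 * s \<le> \<sigma>0 * (t0 + w)" using sw \<sigma> by (intro mult_left_mono) auto
  moreover have "\<sigma>0 * w \<le> w" using \<sigma> w0 by (simp add: mult_left_le_one_le)
  ultimately have "\<sigma>1 * t0 - \<sigma>0 * t0 - \<kappa> * t0 \<le> 2 * w" by (simp add: algebra_simps)
  moreover have "\<sigma>1 * t0 - \<sigma>0 * t0 = 4 * (\<kappa> * t0)" by (simp add: \<kappa> algebra_simps)
  moreover have "0 < \<kappa> * t0" using pos t0 by simp
  ultimately show "\<kappa> * t0 \<le> norm (y z)" unfolding w_def by linarith
  have "norm z \<le> norm (fst z) + norm (snd z)" using norm_Pair_le[of "fst z" "snd z"] by simp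
  also have "\<dots> \<le> s + s" using r1 s0 \<sigma> mult_left_le_one_le[of s \<sigma>1] by (simp add: r_def s_def)
  also have "\<dots> \<le> T * t0" using s2 \<sigma> by (simp add: T s_def field_simps)
  finally show nz: "norm z \<le> T * t0" .
  have "norm z0 \<le> norm t0 + norm ((\<sigma>1 * t0) *\<^sub>R e)" unfolding z0_def by (rule norm_Pair_le)
  also have "\<dots> \<le> 2 * t0" using st \<sigma> t0 e by simp
  also have "2 * t0 \<le> T * t0" using \<sigma> t0 by (intro mult_right_mono) (auto simp: T field_simps)
  finally have "norm z0 \<le> T * t0" .
  then show "norm (z - z0) \<le> 2 * T * t0" using norm_triangle_ineq4[of z z0] nz by linarith
qed

lemma compact_K: "compact K"
proof -
  have "closed K" unfolding K_def
    by (intro closed_Collect_conj closed_Collect_le continuous_intros continuous_f continuous_u)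
  moreover have "bounded K" using K_geometry(5) bounded_iff by blast
  ultimately show ?thesis by (simp add: compact_eq_bounded_closed)
qed

text \<open>The gap \<sigma>1 - \<sigma>0 is 4 \<kappa>. A time shift by \<kappa> t0 costs at most
  \<kappa> t0 of it, leaving |x - x0| \<ge> 3 \<kappa> t0 against |t - t0| \<le> \<kappa> t0; the
  difference of the squares is the 8.\<close>

lemma inner_region:
  assumes z: "norm (snd z) < \<sigma>0 * fst z" "inverse (1 + \<kappa>) * t0 < fst z" "fst z < (1 + \<kappa>) * t0"
  shows "u z \<le> 0" "8 * \<kappa>\<^sup>2 * t0\<^sup>2 \<le> f z" "z \<in> K"
proof -
  define r s w where "r = norm (snd z)" and "s = fst z" and "w = norm (y z)"
  have "r\<^sup>2 \<le> (\<sigma>0 * s)\<^sup>2" using z by (intro power_mono) (auto simp: r_def s_def)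
  then show u0: "u z \<le> 0" using pos t0
    by (simp add: u_eq r_def s_def power_mult_distrib divide_le_0_iff)
  have rw: "\<sigma>1 * t0 \<le> r + w"
    using norm_triangle_ineq4[of "snd z" "snd z - (\<sigma>1 * t0) *\<^sub>R e"] \<sigma> t0 e
    by (auto simp: w_def r_def y_def z0_def norm_Pair)
  have "\<sigma>0 * s \<le> \<sigma>0 * ((1 + \<kappa>) * t0)" using z \<sigma> by (intro mult_left_mono) (auto simp: s_def)
  moreover have "\<sigma>0 * (\<kappa> * t0) \<le> \<kappa> * t0" using \<sigma> pos t0 by (simp add: mult_left_le_one_le)
  moreover have "\<sigma>1 * t0 - \<sigma>0 * t0 = 4 * (\<kappa> * t0)" by (simp add: \<kappa> algebra_simps)
  ultimately have "3 * (\<kappa> * t0) \<le> w" using rw z(1) by (simp add: r_def s_def algebra_simps)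
  then have w: "(3 * (\<kappa> * t0))\<^sup>2 \<le> w\<^sup>2" using pos t0 by (intro power_mono) auto
  have "(1 - \<kappa>) * (1 + \<kappa>) \<le> 1" by (simp add: algebra_simps)
  then have "1 - \<kappa> \<le> inverse (1 + \<kappa>)" using pos by (simp add: field_simps)
  from mult_right_mono[OF this, of t0] have "\<bar>s - t0\<bar> \<le> \<kappa> * t0"
    using z t0 by (auto simp: s_def algebra_simps abs_le_iff)
  then have "(s - t0)\<^sup>2 \<le> (\<kappa> * t0)\<^sup>2" by (simp add: abs_le_square_iff[symmetric])
  with w show f8: "8 * \<kappa>\<^sup>2 * t0\<^sup>2 \<le> f z" by (simp add: f_eq w_def s_def power_mult_distrib)
  have "0 \<le> 8 * \<kappa>\<^sup>2 * t0\<^sup>2" by simp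
  then have "0 \<le> f z" using f8 by (rule order_trans)
  then show "z \<in> K" using u0 by (simp add: K_def)
qed

lemma annular_region:
  assumes "0 < u z"
  shows "\<sigma>0 * fst z < norm (snd z)"
proof (rule power2_less_imp_less)
  show "(\<sigma>0 * fst z)\<^sup>2 < (norm (snd z))\<^sup>2"
  proof -
    have "0 < (\<delta> * t0)\<^sup>2" using pos t0 by simp
    then show ?thesis using assms by (auto simp: u_eq zero_less_divide_iff power_mult_distrib)
  qed
qed simp

section \<open>Derivatives and divergences of the weight fields\<close>

lemma C1_f: "C1_deriv \<Omega> f (\<lambda>z h. 2 * (J (z - z0) \<bullet> h))"
proof -
  note S = C1_deriv_shift[of \<Omega> z0]
  show ?thesis unfolding f_def[abs_def]
    by (rule C1_deriv_cong[OF C1_deriv_inner[OF S C1_deriv_linear_comp[OF J(1) S]]])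
      (metis J(2) inner_commute mult_2)
qed

lemma C1_chi: "C1_deriv \<Omega> (\<lambda>z. cutoff (u z)) (\<lambda>z h. cutoff' (u z) * B z h)"
  by (rule C1_deriv_real_comp[OF C1_u DERIV_cutoff continuous_on_cutoff(2)])

lemma C1_k: "C1_deriv \<Omega> k k'"
  unfolding k_def[abs_def]
  by (rule C1_deriv_cong[OF C1_deriv_mult[OF C1_deriv_real_comp[OF C1_u DERIV_cutoff' continuous_on_cutoff(3)]
    C1_deriv_bilinear_quadratic[OF B_bilinear]]]) (simp add: k'_def)

lemma C1_deriv_y: "C1_deriv \<Omega> y (\<lambda>z h. (0, snd h))"
proof -
  have lin: "bounded_linear (\<lambda>h::real \<times> 'b. (0::real, snd h))"
    by (intro bounded_linear_Pair bounded_linear_zero bounded_linear_snd)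
  show ?thesis unfolding y_def[abs_def]
    by (rule C1_deriv_cong[OF C1_deriv_linear_comp[OF lin C1_deriv_shift]]) simp
qed

lemma C1_div_y: "C1_div \<Omega> y (\<lambda>_. real DIM('b))"
proof -
  have "(\<Sum>h\<in>Basis. (0::real, snd h) \<bullet> (h :: real \<times> 'b)) = real DIM('b)"
    by (simp add: sum_Basis_prod inner_same_Basis)
  with C1_deriv_y show ?thesis unfolding C1_div_def by (intro exI[of _ "\<lambda>z h. (0, snd h)"]) auto
qed

lemma C1_div_Y:
  assumes "\<And>z. z \<in> \<Omega> \<Longrightarrow> y z \<noteq> 0"
  shows "C1_div \<Omega> Y dY"
proof -
  have 1: "C1_deriv \<Omega> (\<lambda>z. y z \<bullet> y z) (\<lambda>z h. 2 * (y z \<bullet> (0, snd h)))"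
    by (rule C1_deriv_cong[OF C1_deriv_inner[OF C1_deriv_y C1_deriv_y]]) (simp add: inner_commute)
  have 2: "C1_deriv \<Omega> (\<lambda>z. inverse (y z \<bullet> y z)) (\<lambda>z h. - (inverse (y z \<bullet> y z))\<^sup>2 * (2 * (y z \<bullet> (0, snd h))))"
  proof (rule C1_deriv_real_comp[OF 1, where g = inverse and g' = "\<lambda>r. - (inverse r)\<^sup>2"])
    show "(inverse has_real_derivative - (inverse (y z \<bullet> y z))\<^sup>2) (at (y z \<bullet> y z))" if "z \<in> \<Omega>" for z
      using assms[OF that] DERIV_inverse[of "y z \<bullet> y z"] by (simp add: power2_eq_square)
    show "continuous_on ((\<lambda>z. y z \<bullet> y z) ` \<Omega>) (\<lambda>r. - (inverse r)\<^sup>2)"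
      using assms by (auto intro!: continuous_intros)
  qed
  show ?thesis unfolding Y_def[abs_def]
  proof (rule C1_div_cong[OF C1_div_scaleR[OF 2 C1_div_y]])
    fix z assume "z \<in> \<Omega>"
    then have "y z \<bullet> y z \<noteq> 0" using assms by simp
    moreover have "(0, snd (y z)) = y z" by (simp add: y_def)
    ultimately show "- (inverse (y z \<bullet> y z))\<^sup>2 * (2 * (y z \<bullet> (0, snd (y z)))) + inverse (y z \<bullet> y z) * real DIM('b) = dY z"
      by (simp add: dY_def field_simps power2_eq_square)
  qed
qed

lemma C1_div_Z: "\<exists>d. C1_div \<Omega> Z d \<and> continuous_on \<Omega> d"
proof -
  have 1: "C1_deriv \<Omega> (\<lambda>z. cutoff (u z / 2)) (\<lambda>z h. cutoff' (u z / 2) * (B z h / 2))"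
    by (rule C1_deriv_real_comp[OF C1_deriv_linear_comp[OF bounded_linear_divide[of 2] C1_u] DERIV_cutoff continuous_on_cutoff(2)])
  show ?thesis using C1_div_scaleR[OF 1 C1_div_y] C1_div_cont unfolding Z_def[abs_def] by blast
qed

lemma J_y: "J (z - z0) \<bullet> y z = y z \<bullet> y z"
  by (simp add: J_def y_def inner_prod_def)

end

section \<open>Scale-invariant bounds for the cutoff errors\<close>

context cone_weight begin

lemma Y_bounds:
  assumes "z \<in> K"
  shows "norm (Y z) \<le> 1 / (\<kappa> * t0)" "\<bar>dY z\<bar> \<le> (real DIM('b) + 2) / (\<kappa> * t0)\<^sup>2" "y z \<noteq> 0"
proof -
  have kt: "0 < \<kappa> * t0" using pos t0 by simp
  have y: "\<kappa> * t0 \<le> norm (y z)" using K_geometry(4)[OF assms] .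
  then show "y z \<noteq> 0" using kt by auto
  have "norm (Y z) = 1 / norm (y z)"
    using \<open>y z \<noteq> 0\<close> by (simp add: Y_def dot_square_norm field_simps power2_eq_square)
  also have "\<dots> \<le> 1 / (\<kappa> * t0)" by (rule divide_left_mono[OF y _ mult_pos_pos[OF _ kt]]) (use \<open>y z \<noteq> 0\<close> in auto)
  finally show "norm (Y z) \<le> 1 / (\<kappa> * t0)" .
  have "\<bar>dY z\<bar> \<le> (real DIM('b) + 2) / (norm (y z))\<^sup>2"
    unfolding dY_def dot_square_norm abs_divide by (intro frac_le) (use \<open>y z \<noteq> 0\<close> in auto)
  also have "\<dots> \<le> (real DIM('b) + 2) / (\<kappa> * t0)\<^sup>2"
    using y kt by (intro divide_left_mono mult_pos_pos power_mono) auto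
  finally show "\<bar>dY z\<bar> \<le> (real DIM('b) + 2) / (\<kappa> * t0)\<^sup>2" .
qed

text \<open>\<open>u\<close> is unchanged when z and t0 are scaled together, so each derivative
  costs a factor 1 / t0 and each displacement gains t0; the constants involve only \<delta>,
  \<kappa>, T and m.\<close>

lemma cutoff_term_bounds:
  assumes z: "z \<in> K" and m: "\<And>r. \<bar>cutoff' r\<bar> \<le> m" "\<And>r. \<bar>cutoff'' r\<bar> \<le> m"
  defines "\<beta> \<equiv> 2 / \<delta>\<^sup>2"
  shows "\<bar>cutoff' (u z) * B z h\<bar> \<le> m * \<beta> * T * norm h / t0"
    and "\<bar>k z\<bar> \<le> 2 * m * \<beta> * T\<^sup>2"
    and "\<bar>k' z (Y z)\<bar> \<le> m * (2 * \<beta>\<^sup>2 * T ^ 3 + 3 * \<beta> * T) / \<kappa> / t0\<^sup>2"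
proof -
  have m0: "0 \<le> m" using m(1)[of 0] by linarith
  have \<beta>: "0 \<le> \<beta>" by (simp add: \<beta>_def)
  have B: "\<bar>B v w\<bar> \<le> \<beta> / t0\<^sup>2 * (norm v * norm w)" for v w
    using B_bound[of v w] by (simp add: \<beta>_def power_mult_distrib)
  have Bz: "\<bar>B z h\<bar> \<le> \<beta> * T * norm h / t0" for h
  proof -
    have "\<beta> / t0\<^sup>2 * (norm z * norm h) \<le> \<beta> / t0\<^sup>2 * ((T * t0) * norm h)"
      using \<beta> K_geometry(5)[OF z] by (intro mult_left_mono mult_right_mono) auto
    also have "\<dots> = \<beta> * T * norm h / t0" using t0 by (simp add: power2_eq_square)
    finally show ?thesis using B[of z h] by linarith
  qed
  have BS: "\<bar>B h (z - z0)\<bar> \<le> 2 * \<beta> * T * norm h / t0" for h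
  proof -
    have "\<beta> / t0\<^sup>2 * (norm h * norm (z - z0)) \<le> \<beta> / t0\<^sup>2 * (norm h * (2 * T * t0))"
      using \<beta> K_geometry(6)[OF z] by (intro mult_left_mono) auto
    also have "\<dots> = 2 * \<beta> * T * norm h / t0" using t0 by (simp add: power2_eq_square)
    finally show ?thesis using B[of h "z - z0"] by linarith
  qed
  have BzS: "\<bar>B z (z - z0)\<bar> \<le> 2 * \<beta> * T\<^sup>2"
  proof -
    have "\<beta> * T * norm (z - z0) / t0 \<le> \<beta> * T * (2 * T * t0) / t0"
      using \<beta> K_geometry(6)[OF z] pos t0 by (intro divide_right_mono mult_left_mono) auto
    also have "\<dots> = 2 * \<beta> * T\<^sup>2" using t0 by (simp add: power2_eq_square)
    finally show ?thesis using Bz[of "z - z0"] by linarith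
  qed
  have "\<bar>cutoff' (u z) * B z h\<bar> \<le> m * (\<beta> * T * norm h / t0)"
    unfolding abs_mult using m m0 Bz by (intro mult_mono) auto
  then show "\<bar>cutoff' (u z) * B z h\<bar> \<le> m * \<beta> * T * norm h / t0" by (simp add: mult.assoc)
  have "\<bar>k z\<bar> \<le> m * (2 * \<beta> * T\<^sup>2)"
    unfolding k_def abs_mult using m m0 BzS by (intro mult_mono) auto
  then show k: "\<bar>k z\<bar> \<le> 2 * m * \<beta> * T\<^sup>2" by (simp add: algebra_simps)
  have nY: "c * norm (Y z) / t0 \<le> c / \<kappa> / t0\<^sup>2" if "0 \<le> c" for c
  proof -
    have "c * norm (Y z) / t0 \<le> c * (1 / (\<kappa> * t0)) / t0"
      using Y_bounds(1)[OF z] t0 that by (intro divide_right_mono mult_left_mono) auto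
    then show ?thesis by (simp add: power2_eq_square)
  qed
  have 1: "\<bar>B z (Y z)\<bar> \<le> \<beta> * T / \<kappa> / t0\<^sup>2"
    using Bz[of "Y z"] nY[of "\<beta> * T"] \<beta> pos by simp
  have 2: "\<bar>B (Y z) (z - z0)\<bar> \<le> 2 * \<beta> * T / \<kappa> / t0\<^sup>2"
    using BS[of "Y z"] nY[of "2 * \<beta> * T"] \<beta> pos by simp
  have 3: "\<bar>cutoff' (u z) * (B z (Y z) + B (Y z) (z - z0))\<bar> \<le> m * (3 * \<beta> * T / \<kappa> / t0\<^sup>2)"
    unfolding abs_mult
  proof (intro mult_mono)
    have "\<bar>B z (Y z) + B (Y z) (z - z0)\<bar> \<le> \<beta> * T / \<kappa> / t0\<^sup>2 + 2 * \<beta> * T / \<kappa> / t0\<^sup>2"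
      by (rule order_trans[OF abs_triangle_ineq add_mono[OF 1 2]])
    also have "\<dots> = 3 * \<beta> * T / \<kappa> / t0\<^sup>2" by (simp add: add_divide_distrib[symmetric])
    finally show "\<bar>B z (Y z) + B (Y z) (z - z0)\<bar> \<le> 3 * \<beta> * T / \<kappa> / t0\<^sup>2" .
  qed (use m m0 in auto)
  have "\<bar>cutoff'' (u z) * B z (Y z)\<bar> \<le> m * (\<beta> * T / \<kappa> / t0\<^sup>2)"
    unfolding abs_mult using m m0 1 by (intro mult_mono) auto
  then have 4: "\<bar>cutoff'' (u z) * B z (Y z) * B z (z - z0)\<bar> \<le> m * (\<beta> * T / \<kappa> / t0\<^sup>2) * (2 * \<beta> * T\<^sup>2)"
    unfolding abs_mult[of "cutoff'' (u z) * B z (Y z)"] using BzS m0 \<beta> pos by (intro mult_mono) auto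
  have "\<bar>k' z (Y z)\<bar> \<le> m * (3 * \<beta> * T / \<kappa> / t0\<^sup>2) + m * (\<beta> * T / \<kappa> / t0\<^sup>2) * (2 * \<beta> * T\<^sup>2)"
    unfolding k'_def using 3 4 by linarith
  also have "\<dots> = m * (2 * \<beta>\<^sup>2 * T ^ 3 + 3 * \<beta> * T) / \<kappa> / t0\<^sup>2"
    by (simp add: add_divide_distrib algebra_simps power2_eq_square power3_eq_cube)
  finally show "\<bar>k' z (Y z)\<bar> \<le> m * (2 * \<beta>\<^sup>2 * T ^ 3 + 3 * \<beta> * T) / \<kappa> / t0\<^sup>2" .
qed

end

text \<open>In terms of g, the length of the gradient, and w = |\<phi>| / t0, every term is a
  quadratic expression with bounded coefficients or a multiple of \<open>N0\<close>; the mixed ones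
  are settled by g w \<le> g^2 + w^2.\<close>

lemma multiplier_error_bound:
  fixes c A \<phi> k U q GY kY dY :: real
  assumes c: "\<bar>c\<bar> \<le> M1 * g / t0" and A: "\<bar>A\<bar> \<le> 2 * T * t0 * g" and k: "\<bar>k\<bar> \<le> M2" and q: "\<bar>q\<bar> \<le> g\<^sup>2"
    and U: "\<bar>U\<bar> \<le> C * N0" and GY: "\<bar>GY\<bar> \<le> g / (\<kappa> * t0)" and kY: "\<bar>kY\<bar> \<le> M3 / t0\<^sup>2"
    and dY: "\<bar>dY\<bar> \<le> M4 / t0\<^sup>2" and t0: "t0 > 0" and \<kappa>: "\<kappa> > 0"
    and nn: "0 \<le> b" "0 \<le> M1" "0 \<le> M3" "0 \<le> M4" "0 \<le> g" "0 \<le> T" "0 \<le> C" "0 \<le> N0"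
  shows "\<bar>c * (A + b * \<phi>) + k * (U - q / 2) - b / 2 * (2 * \<phi> * GY * k + \<phi>\<^sup>2 * kY + \<phi>\<^sup>2 * k * dY)\<bar>
    \<le> (M1 * (2 * T + b) + M2 * (C + 1) + b / 2 * (2 * M2 / \<kappa> + M3 + M2 * M4)) * (g\<^sup>2 + N0 + \<phi>\<^sup>2 / t0\<^sup>2)"
proof -
  define w where "w = \<bar>\<phi>\<bar> / t0"
  define D where "D = g\<^sup>2 + N0 + w\<^sup>2"
  have w: "\<bar>\<phi>\<bar> = w * t0" "0 \<le> w" using t0 by (auto simp: w_def)
  have \<phi>2: "\<phi>\<^sup>2 = w\<^sup>2 * t0\<^sup>2" using w(1) by (metis power2_abs power_mult_distrib)
  have D: "\<phi>\<^sup>2 / t0\<^sup>2 = w\<^sup>2" "0 \<le> D" "g\<^sup>2 \<le> D" "N0 \<le> D" "w\<^sup>2 \<le> D" "g\<^sup>2 + N0 \<le> D"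
    using t0 nn by (auto simp: \<phi>2 D_def)
  have gw: "g * w \<le> D"
  proof -
    have "2 * (g * w) \<le> g\<^sup>2 + w\<^sup>2" using sum_squares_bound[of g w] by simp
    moreover have "0 \<le> g * w" using w nn by simp
    ultimately show ?thesis using nn by (simp add: D_def)
  qed
  have M2: "0 \<le> M2" using k by linarith
  have "\<bar>A + b * \<phi>\<bar> \<le> t0 * (2 * T * g + b * w)"
    using A nn abs_triangle_ineq[of A "b * \<phi>"] by (simp add: abs_mult w(1) algebra_simps)
  then have "\<bar>c * (A + b * \<phi>)\<bar> \<le> M1 * g / t0 * (t0 * (2 * T * g + b * w))"
    unfolding abs_mult using c nn t0 by (intro mult_mono) auto
  also have "\<dots> = M1 * (2 * T * g\<^sup>2 + b * (g * w))" using t0 by (simp add: algebra_simps power2_eq_square)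
  also have "\<dots> \<le> M1 * (2 * T * D + b * D)"
    using D gw nn by (intro mult_left_mono add_mono) auto
  finally have 1: "\<bar>c * (A + b * \<phi>)\<bar> \<le> M1 * (2 * T + b) * D" by (simp add: algebra_simps)
  have "\<bar>k * (U - q / 2)\<bar> \<le> M2 * (C * D + D)"
    unfolding abs_mult
  proof (intro mult_mono)
    have "C * N0 \<le> C * D" using D nn by (intro mult_left_mono) auto
    then show "\<bar>U - q / 2\<bar> \<le> C * D + D" using U q D(3) by linarith
  qed (use k M2 in auto)
  then have 2: "\<bar>k * (U - q / 2)\<bar> \<le> M2 * (C + 1) * D" by (simp add: algebra_simps)
  have "\<bar>2 * \<phi> * GY * k\<bar> \<le> 2 * (w * t0) * (g / (\<kappa> * t0)) * M2"
    unfolding abs_mult w(1)[symmetric] using GY k nn M2 \<kappa> t0 by (intro mult_mono) auto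
  also have "\<dots> = 2 * M2 / \<kappa> * (g * w)" using t0 by simp
  also have "\<dots> \<le> 2 * M2 / \<kappa> * D" using gw M2 \<kappa> by (intro mult_left_mono) auto
  finally have 3: "\<bar>2 * \<phi> * GY * k\<bar> \<le> 2 * M2 / \<kappa> * D" .
  have "\<bar>\<phi>\<^sup>2 * kY\<bar> \<le> (w\<^sup>2 * t0\<^sup>2) * (M3 / t0\<^sup>2)"
    unfolding abs_mult using kY \<phi>2 by (intro mult_mono) auto
  also have "\<dots> = M3 * w\<^sup>2" using t0 by simp
  also have "\<dots> \<le> M3 * D" using D nn by (intro mult_left_mono) auto
  finally have 4: "\<bar>\<phi>\<^sup>2 * kY\<bar> \<le> M3 * D" .
  have "\<bar>\<phi>\<^sup>2 * k * dY\<bar> \<le> (w\<^sup>2 * t0\<^sup>2) * M2 * (M4 / t0\<^sup>2)"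
    unfolding abs_mult using k dY \<phi>2 M2 by (intro mult_mono) auto
  also have "\<dots> = M2 * M4 * w\<^sup>2" using t0 by simp
  also have "\<dots> \<le> M2 * M4 * D" using D nn M2 by (intro mult_left_mono) auto
  finally have 5: "\<bar>\<phi>\<^sup>2 * k * dY\<bar> \<le> M2 * M4 * D" .
  have "\<bar>2 * \<phi> * GY * k + \<phi>\<^sup>2 * kY + \<phi>\<^sup>2 * k * dY\<bar> \<le> (2 * M2 / \<kappa> + M3 + M2 * M4) * D"
    using 3 4 5 by (simp only: distrib_right)
  then have "b / 2 * \<bar>2 * \<phi> * GY * k + \<phi>\<^sup>2 * kY + \<phi>\<^sup>2 * k * dY\<bar> \<le> b / 2 * ((2 * M2 / \<kappa> + M3 + M2 * M4) * D)"
    using nn by (intro mult_left_mono) auto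
  then have 6: "\<bar>b / 2 * (2 * \<phi> * GY * k + \<phi>\<^sup>2 * kY + \<phi>\<^sup>2 * k * dY)\<bar> \<le> b / 2 * (2 * M2 / \<kappa> + M3 + M2 * M4) * D"
    using nn by (simp add: abs_mult mult.assoc)
  show ?thesis unfolding D(1) D_def[symmetric] using 1 2 6 by (simp only: distrib_right)
qed

section \<open>The weighted estimate on the compact region\<close>

context cone_weight begin

text \<open>The good term is kept only on \<open>R\<close>, where f is at least 8 \<kappa>^2 t0^2;
  the errors live where u > 0 and carry f^a, at most (4 T^2 t0^2)^a. The weights on both sides scale
  like t0^(2a), which can be cancelled afterwards.\<close>

lemma interior_estimate:
  fixes \<phi> V :: "real \<times> 'b \<Rightarrow> real" and G :: "real \<times> 'b \<Rightarrow> real \<times> 'b" and a b c m p C :: real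
  assumes \<Omega>: "open \<Omega>" "K \<subseteq> \<Omega>"
    and \<phi>: "C1_deriv \<Omega> \<phi> (\<lambda>z h. G z \<bullet> h)" and G: "C1_deriv \<Omega> G H" and V: "C1_deriv \<Omega> V V'"
    and wave: "\<And>z. z \<in> \<Omega> \<Longrightarrow> (\<Sum>h\<in>Basis. J (H z h) \<bullet> h) + V z * (\<bar>\<phi> z\<bar> powr (p - 1) * \<phi> z) = 0"
    and p: "1 \<le> p" and a: "0 < a" and b: "b = a + (real DIM('b) - 1) / 2"
    and VC: "\<And>z. z \<in> \<Omega> \<Longrightarrow> 0 \<le> V z \<and> V z \<le> C"
    and C: "0 \<le> C" and c: "0 < c" "\<And>z. z \<in> K \<Longrightarrow> c \<le> (real DIM('b) + 1 - b * (p + 1) + 2 * a) * V z + V' z (z - z0)"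
    and m: "0 < m" "\<And>r. \<bar>cutoff' r\<bar> \<le> m" "\<And>r. \<bar>cutoff'' r\<bar> \<le> m"
    and R: "R \<in> sets borel" "\<And>z. z \<in> R \<Longrightarrow> u z \<le> 0 \<and> 8 * \<kappa>\<^sup>2 * t0\<^sup>2 \<le> f z \<and> z \<in> K"
  defines "M2 \<equiv> 2 * m * (2 / \<delta>\<^sup>2) * T\<^sup>2"
    and "M3 \<equiv> m * (2 * (2 / \<delta>\<^sup>2)\<^sup>2 * T ^ 3 + 3 * (2 / \<delta>\<^sup>2) * T) / \<kappa>"
  defines "M \<equiv> m * (2 / \<delta>\<^sup>2) * T * (2 * T + b) + M2 * (C + 1)
     + b / 2 * (2 * M2 / \<kappa> + M3 + M2 * ((real DIM('b) + 2) / \<kappa>\<^sup>2))"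
  shows "0 \<le> M"
    and "integrable lborel (\<lambda>z. indicator R z * \<bar>\<phi> z\<bar> powr (p + 1))"
    and "integrable lborel (\<lambda>z. indicator (K \<inter> {z. 0 < u z}) z *
           ((norm (G z))\<^sup>2 + \<bar>\<phi> z\<bar> powr (p + 1) + (\<phi> z)\<^sup>2 / t0\<^sup>2))"
    and "c / (p + 1) * (8 * \<kappa>\<^sup>2 * t0\<^sup>2) powr a * integral\<^sup>L lborel (\<lambda>z. indicator R z * \<bar>\<phi> z\<bar> powr (p + 1))
      \<le> M * (4 * T\<^sup>2 * t0\<^sup>2) powr a * integral\<^sup>L lborel (\<lambda>z. indicator (K \<inter> {z. 0 < u z}) z *
           ((norm (G z))\<^sup>2 + \<bar>\<phi> z\<bar> powr (p + 1) + (\<phi> z)\<^sup>2 / t0\<^sup>2))"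
proof -
  define D where "D z = (norm (G z))\<^sup>2 + \<bar>\<phi> z\<bar> powr (p + 1) + (\<phi> z)\<^sup>2 / t0\<^sup>2" for z
  define N0 where "N0 z = \<bar>\<phi> z\<bar> powr (p + 1)" for z
  have b0: "0 < b" using a unfolding b using DIM_positive[where 'a = 'b] by (simp add: add_pos_nonneg Suc_leI)
  have cont: "continuous_on K \<phi>" "continuous_on K G" "continuous_on K V"
    using C1_deriv_cont \<phi> G V \<Omega> continuous_on_subset by metis+
  have contN: "continuous_on K N0" unfolding N0_def using cont p
    by (intro continuous_on_powr' continuous_intros) auto
  have contD: "continuous_on K D" unfolding D_def N0_def[symmetric]
    by (intro continuous_intros contN cont) (use t0 in auto)
  show iR: "integrable lborel (\<lambda>z. indicator R z * \<bar>\<phi> z\<bar> powr (p + 1))"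
  proof -
    have "integrable lborel (\<lambda>z. indicator R z *\<^sub>R (indicator K z *\<^sub>R N0 z))"
      using R contN compact_K by (intro integrable_mult_indicator borel_integrable_compact) auto
    moreover have "indicator R z *\<^sub>R (indicator K z *\<^sub>R N0 z) = indicator R z * \<bar>\<phi> z\<bar> powr (p + 1)" for z
      using R(2)[of z] by (auto simp: indicator_def N0_def)
    ultimately show ?thesis by (simp only:)
  qed
  have openU: "open {z. 0 < u z}" by (intro open_Collect_less continuous_intros continuous_u)
  have iD: "integrable lborel (\<lambda>z. indicator (K \<inter> {z. 0 < u z}) z * D z)"
  proof -
    have "integrable lborel (\<lambda>z. indicator {z. 0 < u z} z *\<^sub>R (indicator K z *\<^sub>R D z))"
      using openU contD compact_K by (intro integrable_mult_indicator borel_integrable_compact) auto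
    moreover have "indicator {z. 0 < u z} z *\<^sub>R (indicator K z *\<^sub>R D z) = indicator (K \<inter> {z. 0 < u z}) z * D z" for z
      by (auto simp: indicator_def)
    ultimately show ?thesis by (simp only:)
  qed
  then show "integrable lborel (\<lambda>z. indicator (K \<inter> {z. 0 < u z}) z *
           ((norm (G z))\<^sup>2 + \<bar>\<phi> z\<bar> powr (p + 1) + (\<phi> z)\<^sup>2 / t0\<^sup>2))"
    by (simp add: D_def)
  have M23: "0 \<le> M2" "0 \<le> M3" using m pos by (auto simp: M2_def M3_def)
  show M0: "0 \<le> M" unfolding M_def using M23 m pos b0 C by (intro add_nonneg_nonneg mult_nonneg_nonneg) auto
  \<comment> \<open>f > 0 already forces a nonzero spatial displacement, so all points of
    \<open>K\<close> with f > 0 belong to this set.\<close>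
  define \<Omega>' where "\<Omega>' = \<Omega> \<inter> {z. 0 < f z} \<inter> {z. y z \<noteq> 0}"
  define S where "S z = z - z0" for z
  define A where "A z = S z \<bullet> G z" for z
  define q where "q z = G z \<bullet> J (G z)" for z
  define U where "U z = V z * N0 z / (p + 1)" for z
  have y0: "y z \<noteq> 0" if "f z > 0" for z
    using that by (auto simp: f_eq)
  have op': "open \<Omega>'" unfolding \<Omega>'_def using \<Omega>(1)
    by (intro open_Int open_Collect_less open_Collect_neq continuous_intros continuous_f continuous_y)
  have sub: "\<Omega>' \<subseteq> \<Omega>" by (auto simp: \<Omega>'_def)
  have dim: "real DIM(real \<times> 'b) = real DIM('b) + 1" by simp
  have YJ: "J (z - z0) \<bullet> Y z = 1" if "z \<in> \<Omega>'" for z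
    using that by (auto simp: \<Omega>'_def Y_def J_y)
  note W = C1_div_multiplier[where \<Omega> = \<Omega>' and J = J and \<phi> = \<phi> and G = G and H = H and V = V and V' = V'
    and X = "\<lambda>z. cutoff (u z)" and X' = "\<lambda>z h. cutoff' (u z) * B z h" and k = k and k' = k' and ?z0.0 = z0
    and f = f and Y = Y and dY = dY and p = p and a = a and b = b, unfolded dim, OF op' J(1,2,3)
    C1_deriv_subset[OF \<phi> sub] C1_deriv_subset[OF G sub] C1_deriv_subset[OF V sub] C1_chi C1_k k_def f_def _
    C1_div_Y YJ p _ wave]
  define WW where "WW z = (cutoff (u z) * (f z powr a * (A z + b * \<phi> z))) *\<^sub>R J (G z)
        + (cutoff (u z) * (f z powr a * (U z - q z / 2) + a * b * f z powr (a - 1) * (\<phi> z)\<^sup>2)) *\<^sub>R S z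
        + (- (b / 2) * (f z powr a * ((\<phi> z)\<^sup>2 * k z))) *\<^sub>R Y z" for z
  define Err where "Err z = cutoff' (u z) * B z (J (G z)) * (A z + b * \<phi> z) + k z * (U z - q z / 2)
            - b / 2 * (2 * \<phi> z * (G z \<bullet> Y z) * k z + (\<phi> z)\<^sup>2 * k' z (Y z) + (\<phi> z)\<^sup>2 * k z * dY z)" for z
  define d where "d z = cutoff (u z) * (2 * a * f z powr (a - 1) * (A z + b * \<phi> z)\<^sup>2
          + f z powr a * ((real DIM('b) + 1 - b * (p + 1) + 2 * a) * V z + V' z (z - z0)) * N0 z / (p + 1))
        + f z powr a * Err z" for z
  have DW: "C1_div \<Omega>' WW d"
    unfolding WW_def[abs_def] d_def[abs_def] Err_def A_def q_def U_def S_def N0_def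
    by (rule W) (use sub in \<open>auto simp: \<Omega>'_def b\<close>)
  obtain dZ where dZ: "C1_div UNIV Z dZ" "continuous_on UNIV dZ" using C1_div_Z by blast
  have "bounded (dZ ` K)"
    using dZ(2) by (intro compact_imp_bounded compact_continuous_image compact_K) (auto intro: continuous_on_subset)
  then obtain DZ where DZ: "\<forall>z\<in>K. \<bar>dZ z\<bar> \<le> DZ" unfolding bounded_iff by auto
  \<comment> \<open>The flux of \<open>WW\<close> through the level sets of f, divided by f^a. The
    factor f gained from z - z0 compensates f^(a-1), so no negative power remains and the expression
    is continuous up to f = 0, hence bounded on \<open>K\<close>.\<close>
  define Bd where "Bd z = 2 * (cutoff (u z) * ((A z + b * \<phi> z) * A z) + f z * cutoff (u z) * (U z - q z / 2)
     + a * b * cutoff (u z) * (\<phi> z)\<^sup>2 - b / 2 * ((\<phi> z)\<^sup>2 * k z))" for z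
  have cK: "continuous_on K (\<lambda>z. cutoff (u z))" "continuous_on K k" "continuous_on K f" "continuous_on K (\<lambda>z. J (G z))"
    using C1_deriv_cont[OF C1_chi] C1_deriv_cont[OF C1_k] continuous_f
      bounded_linear.continuous_on[OF J(1) cont(2)] by auto
  have "continuous_on K Bd"
    unfolding Bd_def A_def q_def U_def S_def using p
    by (intro continuous_intros cK cont contN) auto
  then have "bounded (Bd ` K)" by (intro compact_imp_bounded compact_continuous_image compact_K)
  then obtain MB where MB: "\<forall>z\<in>K. \<bar>Bd z\<bar> \<le> MB" unfolding bounded_iff by auto
  \<comment> \<open>A lower bound for the flux of \<open>Z\<close> where u < 1; where u \<ge> 1 the
    field \<open>WW\<close> is zero.\<close>
  define g0 where "g0 = 2 * (cutoff (1/2) * (\<kappa> * t0)\<^sup>2)"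
  have g0: "0 < g0" using cutoff_half_pos pos t0 by (simp add: g0_def)
  have flux: "2 * (J (z - z0) \<bullet> WW z) = f z powr a * Bd z" if "z \<in> \<Omega>'" for z
  proof -
    have fz: "0 < f z" using that by (simp add: \<Omega>'_def)
    have 1: "J (z - z0) \<bullet> J (G z) = A z" unfolding A_def S_def by (simp only: J(2,3))
    have 2: "J (z - z0) \<bullet> S z = f z" unfolding S_def f_def by (rule inner_commute)
    have F0: "f z powr a = f z * f z powr (a - 1)"
      using fz powr_add[of "f z" 1 "a - 1"] by simp
    show ?thesis
      unfolding WW_def inner_add_right inner_scaleR_right 1 2 YJ[OF that] Bd_def F0
      by (simp add: algebra_simps)
  qed
  have Zf: "2 * (J (z - z0) \<bullet> Z z) = 2 * (cutoff (u z / 2) * (norm (y z))\<^sup>2)" for z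
    by (simp add: Z_def J_y dot_square_norm)
  have fS: "f z \<le> 4 * T\<^sup>2 * t0\<^sup>2" if "z \<in> K" for z
  proof -
    have "f z \<le> norm (z - z0) * norm (J (z - z0))" unfolding f_def by (rule norm_cauchy_schwarz)
    also have "\<dots> = (norm (z - z0))\<^sup>2" by (simp add: J(4) power2_eq_square)
    also have "\<dots> \<le> (2 * T * t0)\<^sup>2" using K_geometry(6)[OF that] by (intro power_mono) auto
    finally show ?thesis by (simp add: power_mult_distrib)
  qed
  have D0: "0 \<le> D z" "0 \<le> N0 z" for z by (auto simp: D_def N0_def)
  have Err_bound: "\<bar>Err z\<bar> \<le> M * D z" if z: "z \<in> K" for z
    unfolding Err_def M_def D_def N0_def[symmetric]
  proof (rule multiplier_error_bound[where T = T and ?M4.0 = "(real DIM('b) + 2) / \<kappa>\<^sup>2"])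
    show "\<bar>cutoff' (u z) * B z (J (G z))\<bar> \<le> m * (2 / \<delta>\<^sup>2) * T * norm (G z) / t0"
      using cutoff_term_bounds(1)[OF z m(2,3), of "J (G z)"] by (simp only: J(4))
    show "\<bar>A z\<bar> \<le> 2 * T * t0 * norm (G z)"
      unfolding A_def S_def using K_geometry(6)[OF z] Cauchy_Schwarz_ineq2[of "z - z0" "G z"]
      by (meson mult_right_mono norm_ge_zero order_trans)
    show "\<bar>k z\<bar> \<le> M2" using cutoff_term_bounds(2)[OF z m(2,3)] by (simp only: M2_def)
    show "\<bar>q z\<bar> \<le> (norm (G z))\<^sup>2"
      using Cauchy_Schwarz_ineq2[of "G z" "J (G z)"] by (simp add: q_def J(4) power2_eq_square)
    have "V z * N0 z \<le> C * N0 z" "0 \<le> V z * N0 z"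
      using VC[of z] \<Omega>(2) z D0[of z] by (auto intro!: mult_right_mono mult_nonneg_nonneg)
    moreover have "V z * N0 z / (p + 1) \<le> V z * N0 z / 1"
      using \<open>0 \<le> V z * N0 z\<close> p by (intro divide_left_mono) auto
    moreover have "0 \<le> V z * N0 z / (p + 1)" using \<open>0 \<le> V z * N0 z\<close> p by simp
    ultimately show "\<bar>U z\<bar> \<le> C * N0 z" unfolding U_def by linarith
    have "\<bar>G z \<bullet> Y z\<bar> \<le> norm (G z) * norm (Y z)" by (rule Cauchy_Schwarz_ineq2)
    also have "\<dots> \<le> norm (G z) * (1 / (\<kappa> * t0))" using Y_bounds(1)[OF z] by (intro mult_left_mono) auto
    finally show "\<bar>G z \<bullet> Y z\<bar> \<le> norm (G z) / (\<kappa> * t0)" by simp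
    show "\<bar>k' z (Y z)\<bar> \<le> M3 / t0\<^sup>2" using cutoff_term_bounds(3)[OF z m(2,3)] by (simp only: M3_def)
    show "\<bar>dY z\<bar> \<le> (real DIM('b) + 2) / \<kappa>\<^sup>2 / t0\<^sup>2"
      using Y_bounds(2)[OF z] by (simp add: power_mult_distrib)
  qed (use t0 pos b0 m M23 C D0[of z] in auto)
  have "integral\<^sup>L lborel (\<lambda>z. c / (p + 1) * (8 * \<kappa>\<^sup>2 * t0\<^sup>2) powr a * (indicator R z * N0 z))
      \<le> integral\<^sup>L lborel (\<lambda>z. M * (4 * T\<^sup>2 * t0\<^sup>2) powr a * (indicator (K \<inter> {z. 0 < u z}) z * D z))"
  proof (rule integral_le_of_divergence_degenerate[where \<Omega> = \<Omega>' and f = f and K = K and W = WW and d = d and Z = Z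
        and dZ = dZ and a = a and f' = "\<lambda>z h. 2 * (J (z - z0) \<bullet> h)" and D = DZ and M = "\<bar>MB\<bar> / g0"
        and c = "8 * \<kappa>\<^sup>2 * t0\<^sup>2", OF op' C1_f continuous_f _ compact_K])
    show "0 < f z" if "z \<in> \<Omega>'" for z using that by (simp add: \<Omega>'_def)
    show "z \<in> \<Omega>'" if "z \<in> K" "0 < f z" for z using that \<Omega>(2) y0 by (auto simp: \<Omega>'_def)
    show "C1_div \<Omega>' WW d" by (rule DW)
    show "C1_div \<Omega>' Z dZ" using dZ(1) by (rule C1_div_subset) simp
    show "WW z = 0" if "0 < f z" "z \<notin> K" for z
      using that cutoff_ge_1[of "u z"] by (auto simp: K_def WW_def k_def)
    show "Z z = 0" if "0 < f z" "z \<notin> K" for z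
      using that cutoff_ge_1[of "u z / 2"] by (auto simp: K_def Z_def)
    show nn: "0 \<le> 2 * (J (z - z0) \<bullet> Z z)" for z
      unfolding Zf using cutoff_bounds by simp
    show "\<bar>2 * (J (z - z0) \<bullet> WW z)\<bar> \<le> \<bar>MB\<bar> / g0 * f z powr a * (2 * (J (z - z0) \<bullet> Z z))"
      if z: "z \<in> \<Omega>' \<inter> K" for z
    proof (cases "1 \<le> u z")
      case True
      then have "WW z = 0" using cutoff_ge_1[of "u z"] by (simp add: WW_def k_def)
      then show ?thesis using nn[of z] g0 by simp
    next
      case False
      have "g0 \<le> 2 * (J (z - z0) \<bullet> Z z)"
        unfolding Zf g0_def using False K_geometry(4) z pos t0 cutoff_bounds
        by (intro mult_left_mono mult_mono power_mono cutoff_antimono) auto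
      have "\<bar>2 * (J (z - z0) \<bullet> WW z)\<bar> \<le> f z powr a * \<bar>MB\<bar>"
        using flux[of z] MB z by (force simp: abs_mult intro!: mult_left_mono)
      also have "\<dots> = \<bar>MB\<bar> / g0 * f z powr a * g0" using g0 by simp
      also have "\<dots> \<le> \<bar>MB\<bar> / g0 * f z powr a * (2 * (J (z - z0) \<bullet> Z z))"
        using g0 \<open>g0 \<le> _\<close> by (intro mult_left_mono) auto
      finally show ?thesis .
    qed
    show "\<bar>dZ z\<bar> \<le> DZ" if "z \<in> \<Omega>' \<inter> K" for z using DZ that by auto
    show "0 < a" "0 \<le> \<bar>MB\<bar> / g0" "0 < 8 * \<kappa>\<^sup>2 * t0\<^sup>2" using a g0 pos t0 by auto
    show "integrable lborel (\<lambda>z. c / (p + 1) * (8 * \<kappa>\<^sup>2 * t0\<^sup>2) powr a * (indicator R z * N0 z))"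
      using iR unfolding N0_def by (intro integrable_mult_right)
    show "integrable lborel (\<lambda>z. M * (4 * T\<^sup>2 * t0\<^sup>2) powr a * (indicator (K \<inter> {z. 0 < u z}) z * D z))"
      using iD by (intro integrable_mult_right)
    show "z \<in> \<Omega>' \<inter> K \<and> 8 * \<kappa>\<^sup>2 * t0\<^sup>2 \<le> f z"
      if "c / (p + 1) * (8 * \<kappa>\<^sup>2 * t0\<^sup>2) powr a * (indicator R z * N0 z) \<noteq> 0" for z
    proof -
      have zR: "z \<in> R" using that by (auto simp: indicator_def split: if_splits)
      have "0 < 8 * \<kappa>\<^sup>2 * t0\<^sup>2" using pos t0 by simp
      then have "0 < f z" using R(2)[OF zR] by linarith
      then show ?thesis using R(2)[OF zR] \<Omega>(2) y0 by (auto simp: \<Omega>'_def)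
    qed
    show "0 \<le> c / (p + 1) * (8 * \<kappa>\<^sup>2 * t0\<^sup>2) powr a * (indicator R z * N0 z)" for z
      using c p D0[of z] by simp
    show "0 \<le> M * (4 * T\<^sup>2 * t0\<^sup>2) powr a * (indicator (K \<inter> {z. 0 < u z}) z * D z)" for z
      using M0 D0[of z] by simp
    show "c / (p + 1) * (8 * \<kappa>\<^sup>2 * t0\<^sup>2) powr a * (indicator R z * N0 z)
        \<le> d z + M * (4 * T\<^sup>2 * t0\<^sup>2) powr a * (indicator (K \<inter> {z. 0 < u z}) z * D z)"
      if z: "z \<in> \<Omega>' \<inter> K" for z
    proof -
      define F where "F = f z powr a"
      have F: "0 \<le> F" "F \<le> (4 * T\<^sup>2 * t0\<^sup>2) powr a"
        using z fS[of z] a by (auto simp: F_def \<Omega>'_def intro!: powr_mono2)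
      have x: "0 \<le> cutoff (u z)" by (rule cutoff_bounds)
      define cc where "cc = (real DIM('b) + 1 - b * (p + 1) + 2 * a) * V z + V' z (z - z0)"
      have cc: "c \<le> cc" using c z by (simp add: cc_def)
      have "c / (p + 1) * (8 * \<kappa>\<^sup>2 * t0\<^sup>2) powr a * (indicator R z * N0 z) \<le> cutoff (u z) * (F * c * N0 z / (p + 1))"
      proof (cases "z \<in> R")
        case True
        have "(8 * \<kappa>\<^sup>2 * t0\<^sup>2) powr a \<le> F" unfolding F_def
          using R(2)[OF True] a by (intro powr_mono2) auto
        then have "c / (p + 1) * N0 z * (8 * \<kappa>\<^sup>2 * t0\<^sup>2) powr a \<le> c / (p + 1) * N0 z * F"
          using c p D0[of z] by (intro mult_left_mono) auto
        then show ?thesis using True R(2)[OF True] cutoff_nonpos(1) by (simp add: algebra_simps)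
      next
        case False
        then show ?thesis using x F c p D0[of z] by simp
      qed
      also have "\<dots> \<le> cutoff (u z) * (2 * a * f z powr (a - 1) * (A z + b * \<phi> z)\<^sup>2 + F * cc * N0 z / (p + 1))"
      proof (rule mult_left_mono[OF _ x])
        have "F * c * N0 z / (p + 1) \<le> F * cc * N0 z / (p + 1)"
          using F cc D0[of z] p by (intro divide_right_mono mult_right_mono mult_left_mono) auto
        moreover have "0 \<le> 2 * a * f z powr (a - 1) * (A z + b * \<phi> z)\<^sup>2" using a by simp
        ultimately show "F * c * N0 z / (p + 1) \<le> 2 * a * f z powr (a - 1) * (A z + b * \<phi> z)\<^sup>2 + F * cc * N0 z / (p + 1)"
          by linarith
      qed
      finally have 1: "c / (p + 1) * (8 * \<kappa>\<^sup>2 * t0\<^sup>2) powr a * (indicator R z * N0 z) \<le> d z - F * Err z"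
        unfolding d_def F_def cc_def by simp
      \<comment> \<open>For u \<le> 0 the cutoff is constant and the error vanishes; this confines
        the right-hand side to the annular region.\<close>
      have "- (F * Err z) \<le> M * (4 * T\<^sup>2 * t0\<^sup>2) powr a * (indicator (K \<inter> {z. 0 < u z}) z * D z)"
      proof (cases "0 < u z")
        case True
        have "F * (- Err z) \<le> F * (M * D z)" using Err_bound[of z] z F by (intro mult_left_mono) auto
        also have "\<dots> \<le> (4 * T\<^sup>2 * t0\<^sup>2) powr a * (M * D z)"
          using F M0 D0[of z] by (intro mult_right_mono) auto
        finally show ?thesis using True z by (simp add: algebra_simps)
      next
        case False
        then have "Err z = 0" using cutoff_nonpos(2,3)[of "u z"] by (simp add: Err_def k_def k'_def)
        then show ?thesis using M0 D0[of z] by simp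
      qed
      with 1 show ?thesis by linarith
    qed
  qed
  then show "c / (p + 1) * (8 * \<kappa>\<^sup>2 * t0\<^sup>2) powr a * integral\<^sup>L lborel (\<lambda>z. indicator R z * \<bar>\<phi> z\<bar> powr (p + 1))
      \<le> M * (4 * T\<^sup>2 * t0\<^sup>2) powr a * integral\<^sup>L lborel (\<lambda>z. indicator (K \<inter> {z. 0 < u z}) z *
           ((norm (G z))\<^sup>2 + \<bar>\<phi> z\<bar> powr (p + 1) + (\<phi> z)\<^sup>2 / t0\<^sup>2))"
    by (simp only: integral_mult_right_zero N0_def D_def)
qed

end

section \<open>Coordinates\<close>

definition gradient :: "('a::euclidean_space \<Rightarrow> real) \<Rightarrow> 'a \<Rightarrow> 'a" where
  "gradient f z = (\<Sum>e\<in>Basis. frechet_derivative f (at z) e *\<^sub>R e)"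

lemma gradient_inner:
  assumes "f differentiable (at z)"
  shows "frechet_derivative f (at z) h = gradient f z \<bullet> h"
proof -
  have "linear (frechet_derivative f (at z))" using assms by (rule linear_frechet_derivative)
  then have "frechet_derivative f (at z) (\<Sum>e\<in>Basis. (h \<bullet> e) *\<^sub>R e) = (\<Sum>e\<in>Basis. (h \<bullet> e) * frechet_derivative f (at z) e)"
    by (simp add: linear_sum linear_scale)
  then have F: "frechet_derivative f (at z) h = (\<Sum>e\<in>Basis. (h \<bullet> e) * frechet_derivative f (at z) e)"
    by (simp only: euclidean_representation)
  show ?thesis unfolding F gradient_def inner_sum_left by (simp add: inner_commute mult.commute)
qed

lemma C1_deriv_frechet:
  "C_diff_on (Suc 0) \<Omega> f \<Longrightarrow> C1_deriv \<Omega> f (\<lambda>z. frechet_derivative f (at z))"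
  by (auto simp: C1_deriv_def frechet_derivative_works[symmetric])

lemma C1_deriv_sum:
  assumes "\<And>i. i \<in> I \<Longrightarrow> C1_deriv \<Omega> (f i) (f' i)"
  shows "C1_deriv \<Omega> (\<lambda>z. \<Sum>i\<in>I. f i z) (\<lambda>z h. \<Sum>i\<in>I. f' i z h)"
  using assms unfolding C1_deriv_def by (auto intro!: has_derivative_sum continuous_on_sum)

lemma C_diff_on_2:
  fixes f :: "'a::euclidean_space \<Rightarrow> real"
  assumes "C_diff_on (Suc (Suc 0)) \<Omega> f"
  shows "C1_deriv \<Omega> f (\<lambda>z h. gradient f z \<bullet> h)"
    and "C1_deriv \<Omega> (gradient f)
      (\<lambda>z h. \<Sum>e\<in>Basis. frechet_derivative (\<lambda>w. frechet_derivative f (at w) e) (at z) h *\<^sub>R e)"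
proof -
  have D: "C1_deriv \<Omega> (\<lambda>z. frechet_derivative f (at z) v)
      (\<lambda>z. frechet_derivative (\<lambda>w. frechet_derivative f (at w) v) (at z))" for v
    using assms by (intro C1_deriv_frechet) simp
  show 1: "C1_deriv \<Omega> (gradient f)
      (\<lambda>z h. \<Sum>e\<in>Basis. frechet_derivative (\<lambda>w. frechet_derivative f (at w) e) (at z) h *\<^sub>R e)"
    unfolding gradient_def[abs_def]
    by (intro C1_deriv_sum C1_deriv_linear_comp[OF bounded_linear_scaleR_left D])
  have "f differentiable (at z)" if "z \<in> \<Omega>" for z using assms that by simp
  then have "(f has_derivative (\<lambda>h. gradient f z \<bullet> h)) (at z)" if "z \<in> \<Omega>" for z
    using that gradient_inner[of f z] frechet_derivative_works[of f "at z"] by (metis ext)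
  moreover have "continuous_on \<Omega> (\<lambda>z. gradient f z \<bullet> h)" for h
    using C1_deriv_cont[OF 1] by (intro continuous_intros)
  ultimately show "C1_deriv \<Omega> f (\<lambda>z h. gradient f z \<bullet> h)" by (simp add: C1_deriv_def)
qed

lemma sum_Basis_cart:
  fixes g :: "real ^ 'n \<Rightarrow> 'c::comm_monoid_add"
  shows "sum g Basis = (\<Sum>i\<in>UNIV. g (axis i 1))"
proof -
  have B: "Basis = range (\<lambda>i. axis i 1 :: real ^ 'n)" by (auto simp: Basis_vec_def)
  have "inj (\<lambda>i. axis i 1 :: real ^ 'n)" by (auto intro!: injI simp: axis_eq_axis)
  then show ?thesis unfolding B by (subst sum.reindex) simp_all
qed

lemma grad_norm_eq: "grad_norm f z = norm (gradient f z)"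
proof -
  have "(norm (gradient f z))\<^sup>2 = (\<Sum>e\<in>Basis. (gradient f z \<bullet> e)\<^sup>2)"
    unfolding power2_norm_eq_inner by (subst euclidean_inner) (simp add: power2_eq_square)
  also have "\<dots> = (\<Sum>e\<in>Basis. (frechet_derivative f (at z) e)\<^sup>2)"
    by (intro sum.cong refl) (simp add: gradient_def inner_sum_left_Basis)
  also have "\<dots> = (partial_t f z)\<^sup>2 + (\<Sum>i\<in>UNIV. (partial_x i f z)\<^sup>2)"
    by (simp add: sum_Basis_prod sum_Basis_cart partial_t_def partial_x_def)
  finally show ?thesis by (simp add: grad_norm_def real_sqrt_unique)
qed

context cone_weight begin

text \<open>Times in \<open>K\<close> lie between (1 - \<sigma>1) / 4 and 3 / (1 - \<sigma>1) times
  t0, and 5 / (1 - \<sigma>1) clears both bounds.\<close>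

lemma K_subset_slab:
  assumes "5 / (1 - \<sigma>1) \<le> \<eta>" and z: "z \<in> K"
  shows "inverse \<eta> * t0 < fst z \<and> fst z < \<eta> * t0 \<and> norm (snd z) < \<sigma>1 * fst z"
proof (intro conjI)
  have s1: "0 < 1 - \<sigma>1" using \<sigma> by simp
  have \<eta>: "0 < \<eta>" using assms(1) s1 by (meson divide_pos_pos less_le_trans zero_less_numeral)
  have e: "5 \<le> \<eta> * (1 - \<sigma>1)" using assms(1) s1 by (simp add: pos_divide_le_eq)
  have "inverse \<eta> < (1 - \<sigma>1) / 4" using e \<eta> by (simp add: field_simps)
  then have "inverse \<eta> * t0 < (1 - \<sigma>1) / 4 * t0" using t0 by (intro mult_strict_right_mono)
  then show "inverse \<eta> * t0 < fst z" using K_geometry(1)[OF z] by linarith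
  have "fst z * (1 - \<sigma>1) \<le> 3 * t0" using K_geometry(2)[OF z] .
  also have "\<dots> < 5 * t0" using t0 by simp
  also have "\<dots> \<le> \<eta> * (1 - \<sigma>1) * t0" using e t0 by (intro mult_right_mono) auto
  finally have "fst z * (1 - \<sigma>1) < (\<eta> * t0) * (1 - \<sigma>1)" by (simp add: mult_ac)
  then show "fst z < \<eta> * t0" using s1 by simp
  show "norm (snd z) < \<sigma>1 * fst z" using K_geometry(3)[OF z] .
qed

end

section \<open>Slicing in time\<close>

lemma open_cone_slab: "open (cone_slab \<sigma> \<gamma> t0)"
proof -
  have "cone_slab \<sigma> \<gamma> t0 = {z. inverse \<gamma> * t0 < fst z} \<inter> {z. fst z < \<gamma> * t0} \<inter> {z. norm (snd z) < \<sigma> * fst z}"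
    by (auto simp: cone_slab_def cone_def)
  also have "open \<dots>" by (intro open_Int open_Collect_less continuous_intros)
  finally show ?thesis .
qed

text \<open>Tonelli in time: a uniform bound on the slices, multiplied by the length of the time
  interval, is what produces the factor t0 in front of the supremum. The bound may be
  infinite.\<close>

lemma nn_integral_slab_le:
  fixes g :: "real \<times> 'b::euclidean_space \<Rightarrow> ennreal"
  assumes g: "g \<in> borel_measurable borel" and I: "I \<in> sets borel"
    and zero: "\<And>t x. t \<notin> I \<Longrightarrow> g (t, x) = 0"
    and le: "\<And>t. t \<in> I \<Longrightarrow> (\<integral>\<^sup>+ x. g (t, x) \<partial>lborel) \<le> B"
  shows "(\<integral>\<^sup>+ z. g z \<partial>lborel) \<le> B * emeasure lborel I"
proof -
  have "(\<integral>\<^sup>+ z. g z \<partial>lborel) = (\<integral>\<^sup>+ t. \<integral>\<^sup>+ x. g (t, x) \<partial>lborel \<partial>lborel)"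
    using g lborel.nn_integral_fst[of g lborel] by (simp add: lborel_prod)
  also have "\<dots> \<le> (\<integral>\<^sup>+ t. B * indicator I t \<partial>lborel)"
    using zero le by (intro nn_integral_mono) (simp split: split_indicator)
  also have "\<dots> = B * emeasure lborel I" using I by (simp add: nn_integral_cmult_indicator)
  finally show ?thesis .
qed

section \<open>Choice of the constants and conclusion\<close>

theorem theorem1p10:
  fixes \<sigma>0 \<sigma>1 p :: real
  assumes "0 < \<sigma>0" and "\<sigma>0 < \<sigma>1" and "\<sigma>1 < 1"
    and "1 \<le> p"
    and "CARD('n::finite) \<ge> 2 \<Longrightarrow> p < 1 + 4 / (real CARD('n) - 1)"
  shows "\<exists>\<eta>0>1. \<forall>\<eta>\<ge>\<eta>0. \<forall>C>1.
    \<exists>\<alpha>0>0. \<exists>\<gamma>. 1 < \<gamma> \<and> \<gamma> < \<eta> \<and> (\<exists>K>0.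
      \<forall>t0>0. \<forall>\<alpha>. 0 < \<alpha> \<longrightarrow> \<alpha> \<le> \<alpha>0 \<longrightarrow>
      (\<forall>V \<phi> :: real \<times> (real ^ 'n) \<Rightarrow> real.
        C_diff_on 1 (cone_slab \<sigma>1 \<eta> t0) V \<longrightarrow>
        (\<forall>z\<in>cone_slab \<sigma>1 \<eta> t0. inverse C \<le> V z \<and> V z \<le> C \<and> grad_norm V z \<le> \<alpha> * inverse t0) \<longrightarrow>
        C_diff_on 2 (cone_slab \<sigma>1 \<eta> t0) \<phi> \<longrightarrow>
        (\<forall>z\<in>cone_slab \<sigma>1 \<eta> t0. wave_op \<phi> z + V z * \<bar>\<phi> z\<bar> powr (p - 1) * \<phi> z = 0) \<longrightarrow>
        (\<integral>\<^sup>+ z \<in> cone_slab \<sigma>0 \<gamma> t0. ennreal (\<bar>\<phi> z\<bar> powr (p + 1)) \<partial>lborel)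
        \<le> ennreal (K * t0) *
          (SUP \<tau>\<in>{inverse \<eta> * t0 <..< \<eta> * t0}.
            \<integral>\<^sup>+ x \<in> {x. (\<tau>, x) \<in> annulus \<sigma>0 \<sigma>1 \<tau>}.
              ennreal ((grad_norm \<phi> (\<tau>, x))\<^sup>2 + \<bar>\<phi> (\<tau>, x)\<bar> powr (p + 1)
                + inverse (t0\<^sup>2) * \<bar>\<phi> (\<tau>, x)\<bar>\<^sup>2) \<partial>lborel)))"
proof -
  define \<delta> \<kappa> T where "\<delta> = (1 - \<sigma>1) / 4 * ((\<sigma>1 - \<sigma>0) / 2)" and "\<kappa> = (\<sigma>1 - \<sigma>0) / 4" and "T = 6 / (1 - \<sigma>1)"
  define n where "n = real CARD('n)"
  have n1: "1 \<le> n" by (simp add: n_def Suc_leI)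
  \<comment> \<open>The bulk coefficient \<open>n + 1 - b * (p + 1) + 2 * a\<close> at a = 0. For n
    = 1 it equals 2 whatever p is, in line with the absence of an upper bound on p.\<close>
  define c0 where "c0 = n + 1 - (p + 1) * (n - 1) / 2"
  have c0: "0 < c0"
  proof (cases "CARD('n) \<ge> 2")
    case True
    then have "p < 1 + 4 / (n - 1)" "0 < n - 1" using assms(5) by (auto simp: n_def)
    then have "(p - 1) * (n - 1) < 4" by (simp add: field_simps)
    then show ?thesis by (simp add: c0_def field_simps)
  next
    case False
    moreover have "CARD('n) \<noteq> 0" by simp
    ultimately have "CARD('n) = 1" by linarith
    then have "n = 1" by (simp add: n_def)
    then show ?thesis by (simp add: c0_def)
  qed
  \<comment> \<open>A positive a lowers the coefficient to c0 - a (p - 1). The denominator 2 p keeps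
    the loss below c0 / 2 and also serves p = 1.\<close>
  define a b where "a = c0 / (2 * p)" and "b = a + (n - 1) / 2"
  have a: "0 < a" using c0 assms(4) by (simp add: a_def)
  have cU: "c0 / 2 \<le> n + 1 - b * (p + 1) + 2 * a"
  proof -
    have "a * (2 * p) = c0" using assms(4) by (simp add: a_def)
    then have "a * (p - 1) \<le> c0 / 2" using a by (simp add: algebra_simps)
    moreover have "n + 1 - b * (p + 1) + 2 * a = c0 - a * (p - 1)"
      by (simp add: b_def c0_def field_simps)
    ultimately show ?thesis by simp
  qed
  obtain m where m: "0 < m" "\<And>r. \<bar>cutoff' r\<bar> \<le> m" "\<And>r. \<bar>cutoff'' r\<bar> \<le> m"
    using cutoff_derivs_bounded by blast
  have \<kappa>: "0 < \<kappa>" "\<kappa> < 1" using assms by (auto simp: \<kappa>_def)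
  have T: "0 < T" using assms by (simp add: T_def)
  define M2 M3 where "M2 = 2 * m * (2 / \<delta>\<^sup>2) * T\<^sup>2"
    and "M3 = m * (2 * (2 / \<delta>\<^sup>2)\<^sup>2 * T ^ 3 + 3 * (2 / \<delta>\<^sup>2) * T) / \<kappa>"
  define M where "M C = m * (2 / \<delta>\<^sup>2) * T * (2 * T + b) + M2 * (C + 1)
     + b / 2 * (2 * M2 / \<kappa> + M3 + M2 * ((n + 2) / \<kappa>\<^sup>2))" for C
  \<comment> \<open>The error constant over the coercivity constant, times the ratio of the upper to
    the lower bound of the weight. The absolute value makes the sign available before t0 and \<phi>
    are fixed; that \<open>M C\<close> is nonnegative comes out of the estimate later.\<close>
  define A where "A C = \<bar>M C\<bar> / (c0 / (4 * C) / (p + 1)) * ((4 * T\<^sup>2) / (8 * \<kappa>\<^sup>2)) powr a" for C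
  show ?thesis
  proof (intro exI conjI allI impI)
    show "1 < 5 / (1 - \<sigma>1)" using assms by (simp add: field_simps)
    fix \<eta> C :: real assume \<eta>: "5 / (1 - \<sigma>1) \<le> \<eta>" and C: "1 < C"
    have "5 \<le> 5 / (1 - \<sigma>1)" using assms by (simp add: field_simps)
    then have \<eta>5: "5 \<le> \<eta>" using \<eta> by linarith
    \<comment> \<open>On \<open>K\<close> the derivative of V along z - z0 is at most \<alpha> / t0
      times 2 T t0. This \<alpha>0 makes it at most c0 / (4 C), half of the lower bound c0 / (2 C)
      for the main term.\<close>
    show "0 < c0 / (8 * T * C)" using c0 T C by simp
    \<comment> \<open>1 + \<kappa> is the time width on which the weight has its lower
      bound.\<close>
    show "1 < 1 + \<kappa>" "1 + \<kappa> < \<eta>" using \<kappa> \<eta>5 by auto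
    have A0: "0 \<le> A C" using c0 C assms(4) by (simp add: A_def)
    \<comment> \<open>The factor \<eta> comes from the length of the time interval; the added 1
      gives strict positivity even if \<open>A C\<close> is zero.\<close>
    show "0 < A C * \<eta> + 1" using A0 \<eta>5 by (simp add: add_nonneg_pos)
    fix t0 \<alpha> :: real and V \<phi> :: "real \<times> (real ^ 'n) \<Rightarrow> real"
    assume t0: "0 < t0" and \<alpha>: "0 < \<alpha>" "\<alpha> \<le> c0 / (8 * T * C)"
      and V: "C_diff_on 1 (cone_slab \<sigma>1 \<eta> t0) V"
      and Vb: "\<forall>z\<in>cone_slab \<sigma>1 \<eta> t0. inverse C \<le> V z \<and> V z \<le> C \<and> grad_norm V z \<le> \<alpha> * inverse t0"
      and \<phi>: "C_diff_on 2 (cone_slab \<sigma>1 \<eta> t0) \<phi>"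
      and wave: "\<forall>z\<in>cone_slab \<sigma>1 \<eta> t0. wave_op \<phi> z + V z * \<bar>\<phi> z\<bar> powr (p - 1) * \<phi> z = 0"
    obtain e :: "real ^ 'n" where e: "norm e = 1" using vector_choose_size[of 1] by auto
    interpret cw: cone_weight \<sigma>0 \<sigma>1 t0 \<delta> \<kappa> T e
      by unfold_locales (use assms t0 e in \<open>auto simp: \<delta>_def \<kappa>_def T_def\<close>)
    define \<Omega> where "\<Omega> = (cone_slab \<sigma>1 \<eta> t0 :: (real \<times> (real ^ 'n)) set)"
    define R where "R = (cone_slab \<sigma>0 (1 + \<kappa>) t0 :: (real \<times> (real ^ 'n)) set)"
    define H where "H = (\<lambda>z h. \<Sum>e\<in>Basis. frechet_derivative (\<lambda>w. frechet_derivative \<phi> (at w) e) (at z) h *\<^sub>R e)"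
    define D where "D z = (norm (gradient \<phi> z))\<^sup>2 + \<bar>\<phi> z\<bar> powr (p + 1) + (\<phi> z)\<^sup>2 / t0\<^sup>2" for z
    have \<Omega>: "open \<Omega>" unfolding \<Omega>_def by (rule open_cone_slab)
    have K\<Omega>: "cw.K \<subseteq> \<Omega>" using cw.K_subset_slab[OF \<eta>] by (auto simp: \<Omega>_def cone_slab_def cone_def)
    have \<phi>': "C1_deriv \<Omega> \<phi> (\<lambda>z h. gradient \<phi> z \<bullet> h)" and G: "C1_deriv \<Omega> (gradient \<phi>) H"
      using C_diff_on_2[of \<Omega> \<phi>] \<phi> by (auto simp: \<Omega>_def H_def numeral_2_eq_2)
    have V': "C1_deriv \<Omega> V (\<lambda>z. frechet_derivative V (at z))"
      using C1_deriv_frechet[of \<Omega> V] V by (simp add: \<Omega>_def)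
    have dim: "real DIM(real ^ 'n) = n" by (simp add: n_def)
    have He: "H z h \<bullet> e = frechet_derivative (\<lambda>w. frechet_derivative \<phi> (at w) e) (at z) h" if "e \<in> Basis" for z h e
      unfolding H_def using that by (simp add: inner_sum_left_Basis)
    have trace: "(\<Sum>h\<in>Basis. cw.J (H z h) \<bullet> h) = wave_op \<phi> z" for z
    proof -
      have "(\<Sum>h\<in>Basis. cw.J (H z h) \<bullet> h) = (\<Sum>h\<in>Basis. H z h \<bullet> cw.J h)" by (simp only: cw.J(2))
      also have "\<dots> = - (H z (1, 0) \<bullet> (1, 0)) + (\<Sum>i\<in>UNIV. H z (0, axis i 1) \<bullet> (0, axis i 1))"
        by (simp add: sum_Basis_prod sum_Basis_cart cw.J_def inner_prod_def)
      also have "\<dots> = wave_op \<phi> z"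
      proof -
        have "(1, 0) \<in> (Basis :: (real \<times> (real ^ 'n)) set)" by (simp add: Basis_prod_def)
        moreover have "(0, axis i 1) \<in> (Basis :: (real \<times> (real ^ 'n)) set)" for i
          by (auto simp: Basis_prod_def Basis_vec_def)
        ultimately show ?thesis by (simp add: He wave_op_def partial_t_def[abs_def] partial_x_def[abs_def])
      qed
      finally show ?thesis .
    qed
    have coercive: "c0 / (4 * C) \<le> (n + 1 - b * (p + 1) + 2 * a) * V z + frechet_derivative V (at z) (z - cw.z0)"
      if z: "z \<in> cw.K" for z
    proof -
      have z\<Omega>: "z \<in> \<Omega>" using z K\<Omega> by auto
      have "V differentiable (at z)" using V z\<Omega> by (simp add: \<Omega>_def)
      then have "\<bar>frechet_derivative V (at z) (z - cw.z0)\<bar> \<le> norm (gradient V z) * norm (z - cw.z0)"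
        using Cauchy_Schwarz_ineq2 by (simp add: gradient_inner)
      also have "\<dots> \<le> (\<alpha> * inverse t0) * (2 * T * t0)"
        using Vb z\<Omega> cw.K_geometry(6)[OF z] \<alpha> t0
        by (intro mult_mono) (auto simp: \<Omega>_def grad_norm_eq)
      also have "\<dots> = 2 * T * \<alpha>" using t0 by simp
      also have "\<dots> \<le> 2 * T * (c0 / (8 * T * C))" using \<alpha> T by (intro mult_left_mono) auto
      also have "\<dots> = c0 / (4 * C)" using T by simp
      finally have 1: "\<bar>frechet_derivative V (at z) (z - cw.z0)\<bar> \<le> c0 / (4 * C)" .
      have "c0 / 2 * inverse C \<le> (n + 1 - b * (p + 1) + 2 * a) * V z"
        using cU Vb z\<Omega> c0 C by (intro mult_mono) (auto simp: \<Omega>_def)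
      moreover have "c0 / 2 * inverse C = c0 / (4 * C) + c0 / (4 * C)" using C by (simp add: field_simps)
      ultimately show ?thesis using 1 by linarith
    qed
    have RK: "cw.u z \<le> 0 \<and> 8 * \<kappa>\<^sup>2 * t0\<^sup>2 \<le> cw.f z \<and> z \<in> cw.K" if "z \<in> R" for z
      using cw.inner_region[of z] that by (auto simp: R_def cone_slab_def cone_def)
    have RB: "R \<in> sets borel" unfolding R_def by (intro borel_open open_cone_slab)
    have V0: "0 \<le> V z \<and> V z \<le> C" if "z \<in> \<Omega>" for z
    proof -
      have "0 < inverse C" using C by simp
      moreover have "inverse C \<le> V z \<and> V z \<le> C" using Vb that by (simp add: \<Omega>_def)
      ultimately show ?thesis by linarith
    qed
    have wave': "(\<Sum>h\<in>Basis. cw.J (H z h) \<bullet> h) + V z * (\<bar>\<phi> z\<bar> powr (p - 1) * \<phi> z) = 0" if "z \<in> \<Omega>" for z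
      using wave that by (simp add: trace \<Omega>_def mult.assoc)
    have cpos: "0 < c0 / (4 * C)" "0 \<le> C" using c0 C by auto
    note est = cw.interior_estimate[where b = b and c = "c0 / (4 * C)" and C = C and m = m and R = R, unfolded dim,
        OF \<Omega> K\<Omega> \<phi>' G V' wave' assms(4) a b_def V0 cpos(2,1) coercive m RB RK]
    define P where "P = integral\<^sup>L lborel (\<lambda>z. indicator R z * \<bar>\<phi> z\<bar> powr (p + 1))"
    define Q where "Q = integral\<^sup>L lborel (\<lambda>z. indicator (cw.K \<inter> {z. 0 < cw.u z}) z * D z)"
    have M0: "0 \<le> M C"
      unfolding M_def M2_def M3_def by (rule est(1))
    have iP: "integrable lborel (\<lambda>z. indicator R z * \<bar>\<phi> z\<bar> powr (p + 1))"
      by (rule est(2))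
    have iQ: "integrable lborel (\<lambda>z. indicator (cw.K \<inter> {z. 0 < cw.u z}) z * D z)"
      unfolding D_def by (rule est(3))
    have ineq: "c0 / (4 * C) / (p + 1) * (8 * \<kappa>\<^sup>2 * t0\<^sup>2) powr a * P \<le> M C * (4 * T\<^sup>2 * t0\<^sup>2) powr a * Q"
      unfolding P_def Q_def D_def M_def M2_def M3_def by (rule est(4))
    have Q0: "0 \<le> Q" unfolding Q_def D_def by (intro integral_nonneg_AE) auto
    \<comment> \<open>Both weights contain t0^(2a); cancelling it removes the dependence on
      t0.\<close>
    have PQ: "P \<le> A C * Q"
    proof -
      define X Y t where "X = (8 * \<kappa>\<^sup>2) powr a" and "Y = (4 * T\<^sup>2) powr a" and "t = (t0\<^sup>2) powr a"
      have XYt: "0 < X" "0 < Y" "0 < t" using \<kappa> T t0 by (auto simp: X_def Y_def t_def)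
      define c where "c = c0 / (4 * C) / (p + 1)"
      have c: "0 < c" using c0 C assms(4) by (simp add: c_def)
      have "c * (X * t) * P \<le> M C * (Y * t) * Q"
        using ineq unfolding c_def X_def Y_def t_def by (simp add: powr_mult)
      then have "(c * X * P) * t \<le> (M C * Y * Q) * t" by (simp add: mult_ac)
      then have "c * X * P \<le> M C * Y * Q" using XYt by simp
      then have "P \<le> M C * Y * Q / (c * X)" using c XYt by (simp add: field_simps)
      also have "\<dots> = A C * Q"
      proof -
        have "(4 * T\<^sup>2 / (8 * \<kappa>\<^sup>2)) powr a = Y / X" unfolding X_def Y_def by (rule powr_divide)
        then show ?thesis using M0 unfolding A_def c_def[symmetric]
          by (simp only: abs_of_nonneg times_divide_eq_left times_divide_eq_right divide_divide_eq_left)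
      qed
      finally show ?thesis .
    qed
    define I where "I = {inverse \<eta> * t0 <..< \<eta> * t0}"
    \<comment> \<open>A set containing the region of the errors, with the annuli as its time slices,
      since times in \<open>I\<close> are positive. Its openness makes the integrand
      measurable.\<close>
    define TT where "TT = {z :: real \<times> (real ^ 'n). fst z \<in> I \<and> \<sigma>0 * fst z < norm (snd z) \<and> norm (snd z) < \<sigma>1 * fst z}"
    define S where "S = (SUP \<tau>\<in>I. \<integral>\<^sup>+ x \<in> {x. (\<tau>, x) \<in> annulus \<sigma>0 \<sigma>1 \<tau>}.
              ennreal ((grad_norm \<phi> (\<tau>, x))\<^sup>2 + \<bar>\<phi> (\<tau>, x)\<bar> powr (p + 1)
                + inverse (t0\<^sup>2) * \<bar>\<phi> (\<tau>, x)\<bar>\<^sup>2) \<partial>lborel)"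
    have I_pos: "0 < \<tau>" if "\<tau> \<in> I" for \<tau>
      using that t0 \<eta>5 order_less_trans[of 0 "inverse \<eta> * t0" \<tau>] by (simp add: I_def)
    have TT\<Omega>: "TT \<subseteq> \<Omega>" by (auto simp: TT_def I_def \<Omega>_def cone_slab_def cone_def)
    have openTT: "open TT"
    proof -
      have "TT = {z. inverse \<eta> * t0 < fst z} \<inter> {z. fst z < \<eta> * t0} \<inter>
          {z. \<sigma>0 * fst z < norm (snd z)} \<inter> {z. norm (snd z) < \<sigma>1 * fst z}"
        by (auto simp: TT_def I_def)
      also have "open \<dots>" by (intro open_Int open_Collect_less continuous_intros)
      finally show ?thesis .
    qed
    have sub: "cw.K \<inter> {z. 0 < cw.u z} \<subseteq> TT"
      using cw.K_subset_slab[OF \<eta>] cw.annular_region by (auto simp: TT_def I_def)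
    have D0: "0 \<le> D z" for z by (simp add: D_def)
    have contD: "continuous_on TT D"
    proof -
      have c: "continuous_on TT \<phi>" "continuous_on TT (gradient \<phi>)"
        using C1_deriv_cont[OF \<phi>'] C1_deriv_cont[OF G] TT\<Omega> continuous_on_subset by blast+
      have N: "continuous_on TT (\<lambda>z. \<bar>\<phi> z\<bar> powr (p + 1))"
        using assms(4) by (intro continuous_on_powr' continuous_intros c) auto
      show ?thesis unfolding D_def[abs_def]
        by (rule continuous_on_add[OF continuous_on_add[OF _ N]]; intro continuous_intros c)
          (use t0 in auto)
    qed
    have "(\<lambda>z. indicator TT z *\<^sub>R D z) \<in> borel_measurable borel"
      using openTT contD by (intro borel_measurable_continuous_on_indicator) auto
    then have meas: "(\<lambda>z. ennreal (indicator TT z *\<^sub>R D z)) \<in> borel_measurable borel" by measurable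
    have slab: "(\<integral>\<^sup>+ z. ennreal (indicator TT z *\<^sub>R D z) \<partial>lborel) \<le> S * emeasure lborel I"
    proof (rule nn_integral_slab_le[OF meas])
      show "ennreal (indicator TT (t, x) *\<^sub>R D (t, x)) = 0" if "t \<notin> I" for t x
        using that by (simp add: TT_def)
      fix \<tau> assume \<tau>: "\<tau> \<in> I"
      have "ennreal (indicator TT (\<tau>, x) *\<^sub>R D (\<tau>, x)) = ennreal ((grad_norm \<phi> (\<tau>, x))\<^sup>2 + \<bar>\<phi> (\<tau>, x)\<bar> powr (p + 1)
                + inverse (t0\<^sup>2) * \<bar>\<phi> (\<tau>, x)\<bar>\<^sup>2) * indicator {x. (\<tau>, x) \<in> annulus \<sigma>0 \<sigma>1 \<tau>} x" for x
        using \<tau> I_pos[OF \<tau>] by (simp add: TT_def annulus_def indicator_def D_def grad_norm_eq divide_inverse mult.commute)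
      then show "(\<integral>\<^sup>+ x. ennreal (indicator TT (\<tau>, x) *\<^sub>R D (\<tau>, x)) \<partial>lborel) \<le> S"
        unfolding S_def using \<tau> by (simp only:) (rule SUP_upper)
    qed (simp add: I_def)
    have "inverse \<eta> \<le> 1" using \<eta>5 by (simp add: inverse_le_1_iff)
    then have "inverse \<eta> * t0 \<le> \<eta> * t0" using \<eta>5 t0 by (intro mult_right_mono) linarith+
    then have "emeasure lborel I = ennreal (\<eta> * t0 - inverse \<eta> * t0)" by (simp add: I_def)
    also have "\<dots> \<le> ennreal (\<eta> * t0)" using \<eta>5 t0 by (intro ennreal_leI) simp
    finally have len: "emeasure lborel I \<le> ennreal (\<eta> * t0)" .
    have "(\<integral>\<^sup>+ z \<in> R. ennreal (\<bar>\<phi> z\<bar> powr (p + 1)) \<partial>lborel)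
        = (\<integral>\<^sup>+ z. ennreal (indicator R z * \<bar>\<phi> z\<bar> powr (p + 1)) \<partial>lborel)"
      by (intro nn_integral_cong) (simp split: split_indicator)
    also have "\<dots> = ennreal P" unfolding P_def by (rule nn_integral_eq_integral[OF iP]) auto
    also have "\<dots> \<le> ennreal (A C) * ennreal Q"
      using PQ A0 Q0 by (simp add: ennreal_mult[symmetric] ennreal_leI)
    \<comment> \<open>\<open>Q\<close> is finite, but the supremum over the slices need not be, so
      the comparison with it is made between nonnegative integrals.\<close>
    also have "ennreal Q = (\<integral>\<^sup>+ z. ennreal (indicator (cw.K \<inter> {z. 0 < cw.u z}) z * D z) \<partial>lborel)"
      unfolding Q_def by (rule nn_integral_eq_integral[OF iQ, symmetric]) (simp add: D0)
    also have "\<dots> \<le> (\<integral>\<^sup>+ z. ennreal (indicator TT z *\<^sub>R D z) \<partial>lborel)"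
      using sub D0 by (intro nn_integral_mono ennreal_leI) (auto simp: indicator_def)
    also have "\<dots> \<le> S * ennreal (\<eta> * t0)" using slab len by (meson mult_left_mono order_trans zero_le)
    also have "ennreal (A C) * (S * ennreal (\<eta> * t0)) = ennreal (A C * \<eta> * t0) * S"
      using A0 \<eta>5 t0 by (simp add: ennreal_mult mult_ac)
    also have "\<dots> \<le> ennreal ((A C * \<eta> + 1) * t0) * S"
      using t0 by (intro mult_right_mono ennreal_leI) (auto simp: algebra_simps)
    finally have "(\<integral>\<^sup>+ z \<in> R. ennreal (\<bar>\<phi> z\<bar> powr (p + 1)) \<partial>lborel) \<le> ennreal ((A C * \<eta> + 1) * t0) * S"
      by (simp add: mult_left_mono)
    then show "(\<integral>\<^sup>+ z \<in> cone_slab \<sigma>0 (1 + \<kappa>) t0. ennreal (\<bar>\<phi> z\<bar> powr (p + 1)) \<partial>lborel)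
        \<le> ennreal ((A C * \<eta> + 1) * t0) *
          (SUP \<tau>\<in>{inverse \<eta> * t0 <..< \<eta> * t0}.
            \<integral>\<^sup>+ x \<in> {x. (\<tau>, x) \<in> annulus \<sigma>0 \<sigma>1 \<tau>}.
              ennreal ((grad_norm \<phi> (\<tau>, x))\<^sup>2 + \<bar>\<phi> (\<tau>, x)\<bar> powr (p + 1)
                + inverse (t0\<^sup>2) * \<bar>\<phi> (\<tau>, x)\<bar>\<^sup>2) \<partial>lborel)"
      unfolding R_def S_def I_def .
  qed
qed

end
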